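(* Let $X=(\sigma,\tau_0,\tau_1)$ be any of the 44 triples listed in the context, with its associated functions $j,l,h$ on $\triangle$ and its associated transform $\phi\mapsto\widehat\phi$. For functions $f(x,y)$ on $\triangle$ for which there is a function $\phi(x,y)$ such that $f=\widehat{\phi}$ and for which all of the following integrals and sums exist, we have $$\mathcal{L}_{T_X}(f(x,y))=j(x,y)\int_0^\infty e^{-t(l(x,y)-1)}\,\mathcal{K}_{T_X}(\phi(x,t))\,dt=\sum_{k=0}^\infty\langle \phi(x,s),\eta_k(s)\rangle\,E_k(x,y).$$
   Context: Let $\triangle=\{(x,y)\in\mathbb{R}^2: 0<y<x<1\}$. Triangle partition maps. The elements of $S_3$ are written $e,12,13,23,123,132$ and identified with the $3\times 3$ permutation matrices acting on column vectors $v=(v_1,v_2,v_3)^T$ by: $e\,v=v$, $(12)v=(v_2,v_1,v_3)^T$, $(13)v=(v_3,v_2,v_1)^T$, $(23)v=(v_1,v_3,v_2)^T$, $(123)v=(v_2,v_3,v_1)^T$, $(132)v=(v_3,v_1,v_2)^T$. Put $$B=\begin{pmatrix}1&1&1\\0&1&1\\0&0&1\end{pmatrix},\quad A_0=\begin{pmatrix}0&0&1\\1&0&0\\0&1&1\end{pmatrix},\quad A_1=\begin{pmatrix}1&0&1\\0&1&0\\0&0&1\end{pmatrix}.$$ For $X=(\sigma,\tau_0,\tau_1)\in S_3^3$ let $F_0=\sigma A_0\tau_0$, $F_1=\sigma A_1\tau_1$ (matrix products). For $k\ge 0$ and $(x,y)\in\triangle$ write $(d_k,p_k,q_k)^T=BF_1^kF_0B^{-1}(1,x,y)^T$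 and $S_k(x,y)=(p_k/d_k,\,q_k/d_k)$; here $d_k>0$. $S_k$ maps $\triangle$ bijectively onto an open subtriangle $\triangle_k\subset\triangle$, the $\triangle_k$ are pairwise disjoint, and the triangle partition map $T_X$ is defined on $\bigcup_k\triangle_k$ by $T_X=S_k^{-1}$ on $\triangle_k$. Its transfer operator is $$\mathcal{L}_{T_X}f(x,y)=\sum_{(a,b):T_X(a,b)=(x,y)}\frac{f(a,b)}{|\mathrm{Jac}(T_X(a,b))|}=\sum_{k=0}^\infty \frac{1}{d_k(x,y)^3}\,f(S_k(x,y)).$$ The 44 triples are: $(e,e,e)$, $(e,e,12)$, $(e,12,e)$, $(e,13,e)$, $(e,23,e)$, $(e,23,12)$, $(e,123,e)$, $(e,132,e)$; $(12,e,e)$, $(12,e,12)$, $(12,12,12)$, $(12,13,12)$, $(12,23,e)$, $(12,23,12)$, $(12,123,12)$, $(12,132,12)$; $(13,e,13)$, $(13,e,123)$, $(13,12,13)$, $(13,13,13)$, $(13,23,13)$, $(13,23,123)$, $(13,123,13)$, $(13,132,13)$; $(23,e,23)$, $(23,12,23)$, $(23,13,23)$, $(23,23,23)$, $(23,123,23)$, $(23,132,23)$; $(123,e,132)$, $(123,12,132)$, $(123,13,132)$, $(123,23,132)$, $(123,123,132)$, $(123,132,132)$; $(132,e,13)$, $(132,e,123)$, $(132,12,123)$, $(132,13,123)$, $(132,23,13)$, $(132,23,123)$, $(132,123,123)$, $(132,132,123)$. The functions $l,j$ are determined by $\tau_0$: for $\tau_0=e$, $l=\frac{y+1}{x}$,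 $j=\frac1{x^3}$; for $\tau_0=12$, $l=\frac{y+1}{-x+y+1}$, $j=\frac1{(-x+y+1)^3}$; for $\tau_0=13$, $l=\frac{x-2}{y-1}$, $j=\frac1{(1-y)^3}$; for $\tau_0=23$, $l=\frac{x-y+1}{x}$, $j=\frac{1}{x^3}$; for $\tau_0=123$, $l=\frac{x-2}{x-y-1}$, $j=\frac{1}{(-x+y+1)^3}$; for $\tau_0=132$, $l=1-\frac{x}{y-1}$, $j=\frac1{(1-y)^3}$. The function $h$ is determined by $\sigma$: $h=y$ for $\sigma\in\{e,12\}$; $h=1-x$ for $\sigma\in\{13,132\}$; $h=x-y$ for $\sigma\in\{23,123\}$. Let $dm(t)=\frac{t}{e^t-1}\,dt$ on the non-negative reals. The transform $\widehat\phi$ depends on $\sigma$: - $\sigma=e$ or $\sigma=23$: $\widehat\phi(x,y)=\frac{1}{h(x,y)}\int_0^\infty e^{-s\,h(x,y)}\,\phi\left(\frac{y}{x},s\right)dm(s)$; - $\sigma=12$: $\widehat\phi(x,y)=\frac{1}{h(x,y)}\int_0^\infty e^{-s\,h(x,y)}\,\phi\left(\frac{x-1}{y},s\right)dm(s)$; - $\sigma=13$: $\widehat\phi(x,y)=\frac{1}{h(x,y)}\int_0^\infty e^{-s\,h(x,y)}\,\phi\left(s,\frac{1-x}{1-y}\right)dm(s)$; - $\sigma=123$: $\widehat\phi(x,y)=\frac{1}{h(x,y)}\int_0^\infty e^{-s\,h(x,y)}\,\phi\left(\frac{1-y}{x-y},s\right)dm(s)$; - $\sigma=132$: $\widehat\phi(x,y)=\frac{1}{h(x,y)}\int_0^\infty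 e^{-s\,h(x,y)}\,\phi\left(s,\frac{y}{1-x}\right)dm(s)$. Further, with $J_1$ the Bessel function of order one and $L_k^1$ the (associated) Laguerre polynomial of degree $k$ and parameter $1$, $$\mathcal{K}_{T_X}(\phi(x,t))=\int_0^\infty\frac{J_1(2\sqrt{st})}{\sqrt{st}}\,\frac{t}{e^t-1}\,\phi(x,s)\,dm(s),\qquad \eta_k(s)=\frac{s^ke^{-s}}{(k+1)!},\qquad e_k(t)=L_k^1(t),$$ $$E_k(x,y)=\int_0^\infty j(x,y)\,e^{-t(l(x,y)-1)}\,e_k(t)\,dm(t),\qquad \langle\alpha(s),\beta(s)\rangle=\int_0^\infty\alpha(s)\beta(s)\,dm(s).$$
   Formalization: As written the formula fails for most triples; here φ(x,·) means the slice of φ, in its integrated variable, entering f at the k=0 preimage of (x,y); for τ0=e,23 with (σ,τ1)=(e,12),(12,e),(13,123),(132,13) it varies with k, and all preimages are assumed to give the same slice. *)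

theory Defs
  imports "HOL-Analysis.Analysis"
begin

section \<open>Triangle partition maps\<close>

definition open_triangle :: "(real \<times> real) set" where
  "open_triangle = {(x, y). 0 < y \<and> y < x \<and> x < 1}"

datatype s3 = S_e | S_12 | S_13 | S_23 | S_123 | S_132

fun perm_matrix :: "s3 \<Rightarrow> real^3^3" where
  "perm_matrix S_e   = matrix (\<lambda>v::real^3. v)"
| "perm_matrix S_12  = matrix (\<lambda>v::real^3. vector [v$2, v$1, v$3])"
| "perm_matrix S_13  = matrix (\<lambda>v::real^3. vector [v$3, v$2, v$1])"
| "perm_matrix S_23  = matrix (\<lambda>v::real^3. vector [v$1, v$3, v$2])"
| "perm_matrix S_123 = matrix (\<lambda>v::real^3. vector [v$2, v$3, v$1])"
| "perm_matrix S_132 = matrix (\<lambda>v::real^3. vector [v$3, v$1, v$2])"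

definition matB :: "real^3^3" where
  "matB = vector [vector [1, 1, 1], vector [0, 1, 1], vector [0, 0, 1]]"

definition matA0 :: "real^3^3" where
  "matA0 = vector [vector [0, 0, 1], vector [1, 0, 0], vector [0, 1, 1]]"

definition matA1 :: "real^3^3" where
  "matA1 = vector [vector [1, 0, 1], vector [0, 1, 0], vector [0, 0, 1]]"

type_synonym triple = "s3 \<times> s3 \<times> s3"

fun matF0 :: "triple \<Rightarrow> real^3^3" where
  "matF0 (\<sigma>, \<tau>0, \<tau>1) = perm_matrix \<sigma> ** matA0 ** perm_matrix \<tau>0"

fun matF1 :: "triple \<Rightarrow> real^3^3" where
  "matF1 (\<sigma>, \<tau>0, \<tau>1) = perm_matrix \<sigma> ** matA1 ** perm_matrix \<tau>1"

definition dpq :: "triple \<Rightarrow> nat \<Rightarrow> real \<times> real \<Rightarrow> real^3" where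
  "dpq X k = (\<lambda>(x, y).
     (matB ** (((**) (matF1 X)) ^^ k) (matF0 X) ** matrix_inv matB) *v vector [1, x, y])"

definition Sk :: "triple \<Rightarrow> nat \<Rightarrow> real \<times> real \<Rightarrow> real \<times> real" where
  "Sk X k p = (dpq X k p $ 2 / dpq X k p $ 1, dpq X k p $ 3 / dpq X k p $ 1)"

definition tp_domain :: "triple \<Rightarrow> (real \<times> real) set" where
  "tp_domain X = (\<Union>k. Sk X k ` open_triangle)"

text \<open>Only the values on \<open>tp_domain X\<close> are meaningful.\<close>

definition tp_map :: "triple \<Rightarrow> real \<times> real \<Rightarrow> real \<times> real" where
  "tp_map X p = inv_into open_triangle (Sk X (THE k. p \<in> Sk X k ` open_triangle)) p"

definition jac_det :: "(real \<times> real \<Rightarrow> real \<times> real) \<Rightarrow> real \<times> real \<Rightarrow> real" where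
  "jac_det T = (\<lambda>(a, b).
     deriv (\<lambda>u. fst (T (u, b))) a * deriv (\<lambda>v. snd (T (a, v))) b
   - deriv (\<lambda>v. fst (T (a, v))) b * deriv (\<lambda>u. snd (T (u, b))) a)"

definition preimages :: "triple \<Rightarrow> real \<times> real \<Rightarrow> (real \<times> real) set" where
  "preimages X p = {q \<in> tp_domain X. tp_map X q = p}"

definition transfer_operator :: "triple \<Rightarrow> (real \<times> real \<Rightarrow> real) \<Rightarrow> real \<times> real \<Rightarrow> real" where
  "transfer_operator X f p = (\<Sum>\<^sub>\<infinity>q\<in>preimages X p. f q / \<bar>jac_det (tp_map X) q\<bar>)"

definition good_triples :: "triple set" where
  "good_triples =
    {(S_e, S_e, S_e), (S_e, S_e, S_12), (S_e, S_12, S_e), (S_e, S_13, S_e),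
     (S_e, S_23, S_e), (S_e, S_23, S_12), (S_e, S_123, S_e), (S_e, S_132, S_e),
     (S_12, S_e, S_e), (S_12, S_e, S_12), (S_12, S_12, S_12), (S_12, S_13, S_12),
     (S_12, S_23, S_e), (S_12, S_23, S_12), (S_12, S_123, S_12), (S_12, S_132, S_12),
     (S_13, S_e, S_13), (S_13, S_e, S_123), (S_13, S_12, S_13), (S_13, S_13, S_13),
     (S_13, S_23, S_13), (S_13, S_23, S_123), (S_13, S_123, S_13), (S_13, S_132, S_13),
     (S_23, S_e, S_23), (S_23, S_12, S_23), (S_23, S_13, S_23),
     (S_23, S_23, S_23), (S_23, S_123, S_23), (S_23, S_132, S_23),
     (S_123, S_e, S_132), (S_123, S_12, S_132), (S_123, S_13, S_132),
     (S_123, S_23, S_132), (S_123, S_123, S_132), (S_123, S_132, S_132),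
     (S_132, S_e, S_13), (S_132, S_e, S_123), (S_132, S_12, S_123), (S_132, S_13, S_123),
     (S_132, S_23, S_13), (S_132, S_23, S_123), (S_132, S_123, S_123), (S_132, S_132, S_123)}"

section \<open>The functions \<open>l\<close>, \<open>j\<close>, \<open>h\<close>\<close>

fun l_fun :: "triple \<Rightarrow> real \<times> real \<Rightarrow> real" where
  "l_fun (\<sigma>, S_e, \<tau>1)   (x, y) = (y + 1) / x"
| "l_fun (\<sigma>, S_12, \<tau>1)  (x, y) = (y + 1) / (- x + y + 1)"
| "l_fun (\<sigma>, S_13, \<tau>1)  (x, y) = (x - 2) / (y - 1)"
| "l_fun (\<sigma>, S_23, \<tau>1)  (x, y) = (x - y + 1) / x"
| "l_fun (\<sigma>, S_123, \<tau>1) (x, y) = (x - 2) / (x - y - 1)"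
| "l_fun (\<sigma>, S_132, \<tau>1) (x, y) = 1 - x / (y - 1)"

fun j_fun :: "triple \<Rightarrow> real \<times> real \<Rightarrow> real" where
  "j_fun (\<sigma>, S_e, \<tau>1)   (x, y) = 1 / x ^ 3"
| "j_fun (\<sigma>, S_12, \<tau>1)  (x, y) = 1 / (- x + y + 1) ^ 3"
| "j_fun (\<sigma>, S_13, \<tau>1)  (x, y) = 1 / (1 - y) ^ 3"
| "j_fun (\<sigma>, S_23, \<tau>1)  (x, y) = 1 / x ^ 3"
| "j_fun (\<sigma>, S_123, \<tau>1) (x, y) = 1 / (- x + y + 1) ^ 3"
| "j_fun (\<sigma>, S_132, \<tau>1) (x, y) = 1 / (1 - y) ^ 3"

fun h_fun :: "s3 \<Rightarrow> real \<times> real \<Rightarrow> real" where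
  "h_fun S_e   (x, y) = y"
| "h_fun S_12  (x, y) = y"
| "h_fun S_13  (x, y) = 1 - x"
| "h_fun S_132 (x, y) = 1 - x"
| "h_fun S_23  (x, y) = x - y"
| "h_fun S_123 (x, y) = x - y"

section \<open>The transform and the integral operator\<close>

definition dm :: "real measure" where
  "dm = density lebesgue (\<lambda>t. ennreal (indicator {0..} t * (t / (exp t - 1))))"

text \<open>\<open>slice \<sigma> \<phi> p\<close> is the function of \<open>s\<close> to which the transform at the point \<open>p\<close> applies
  \<open>dm\<close>-integration: \<open>s\<close> fills one argument of \<open>\<phi>\<close> (the first one for the permutations 13 and
  132) and the other argument is held fixed.\<close>

fun slice :: "s3 \<Rightarrow> (real \<Rightarrow> real \<Rightarrow> real) \<Rightarrow> real \<times> real \<Rightarrow> real \<Rightarrow> real" where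
  "slice S_e   \<phi> (x, y) s = \<phi> (y / x) s"
| "slice S_23  \<phi> (x, y) s = \<phi> (y / x) s"
| "slice S_12  \<phi> (x, y) s = \<phi> ((x - 1) / y) s"
| "slice S_13  \<phi> (x, y) s = \<phi> s ((1 - x) / (1 - y))"
| "slice S_123 \<phi> (x, y) s = \<phi> ((1 - y) / (x - y)) s"
| "slice S_132 \<phi> (x, y) s = \<phi> s (y / (1 - x))"

definition hat_integrand ::
  "s3 \<Rightarrow> (real \<Rightarrow> real \<Rightarrow> real) \<Rightarrow> real \<times> real \<Rightarrow> real \<Rightarrow> real" where
  "hat_integrand \<sigma> \<phi> p s = exp (- s * h_fun \<sigma> p) * slice \<sigma> \<phi> p s"

definition hat :: "s3 \<Rightarrow> (real \<Rightarrow> real \<Rightarrow> real) \<Rightarrow> real \<times> real \<Rightarrow> real" where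
  "hat \<sigma> \<phi> p = 1 / h_fun \<sigma> p * (LINT s|dm. hat_integrand \<sigma> \<phi> p s)"

text \<open>\<open>phi_slice X \<phi> p\<close> is the function written \<open>\<phi>(x, \<cdot>)\<close> when the operators below are evaluated at
  \<open>p = (x, y)\<close>: the slice of \<open>\<phi>\<close> that enters \<open>f = hat \<sigma> \<phi>\<close> at the preimages \<open>Sk X k p\<close> of \<open>p\<close>.
  For example, \<open>phi_slice (S_e, S_e, S_e) \<phi> (x, y) s = \<phi> x s\<close>, but the fixed argument
  is \<open>1 - x + y\<close> for \<open>(S_e, S_12, S_e)\<close>. It does not depend on \<open>k\<close>, so that \<open>k = 0\<close> may
  be used, except for the eight triples in \<open>varying_triples\<close>, where the fixed argument of
  \<open>\<phi>\<close> at \<open>Sk X k p\<close> changes with \<open>k\<close> and no single slice exists for general \<open>\<phi>\<close>.\<close>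

fun phi_slice :: "triple \<Rightarrow> (real \<Rightarrow> real \<Rightarrow> real) \<Rightarrow> real \<times> real \<Rightarrow> real \<Rightarrow> real" where
  "phi_slice (\<sigma>, \<tau>0, \<tau>1) \<phi> p = slice \<sigma> \<phi> (Sk (\<sigma>, \<tau>0, \<tau>1) 0 p)"

definition varying_triples :: "triple set" where
  "varying_triples =
    {(S_e, S_e, S_12), (S_e, S_23, S_12), (S_12, S_e, S_e), (S_12, S_23, S_e),
     (S_13, S_e, S_123), (S_13, S_23, S_123), (S_132, S_e, S_13), (S_132, S_23, S_13)}"

definition bessel_J1 :: "real \<Rightarrow> real" where
  "bessel_J1 z = (\<Sum>n. (-1) ^ n / (fact n * fact (n + 1)) * (z / 2) ^ (2 * n + 1))"

definition laguerre :: "nat \<Rightarrow> nat \<Rightarrow> real \<Rightarrow> real" where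
  "laguerre a k t = (\<Sum>i\<le>k. (-1) ^ i * real ((k + a) choose (k - i)) * t ^ i / fact i)"

definition K_integrand :: "(real \<Rightarrow> real) \<Rightarrow> real \<Rightarrow> real \<Rightarrow> real" where
  "K_integrand \<psi> t s =
     bessel_J1 (2 * sqrt (s * t)) / sqrt (s * t) * (t / (exp t - 1)) * \<psi> s"

definition K_op :: "(real \<Rightarrow> real) \<Rightarrow> real \<Rightarrow> real" where
  "K_op \<psi> t = (LINT s|dm. K_integrand \<psi> t s)"

definition eta :: "nat \<Rightarrow> real \<Rightarrow> real" where
  "eta k s = s ^ k * exp (- s) / fact (k + 1)"

definition dm_inner :: "(real \<Rightarrow> real) \<Rightarrow> (real \<Rightarrow> real) \<Rightarrow> real" where
  "dm_inner \<alpha> \<beta> = (LINT s|dm. \<alpha> s * \<beta> s)"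

definition E_integrand :: "triple \<Rightarrow> nat \<Rightarrow> real \<times> real \<Rightarrow> real \<Rightarrow> real" where
  "E_integrand X k p t = j_fun X p * exp (- t * (l_fun X p - 1)) * laguerre 1 k t"

definition E_fun :: "triple \<Rightarrow> nat \<Rightarrow> real \<times> real \<Rightarrow> real" where
  "E_fun X k p = (LINT t|dm. E_integrand X k p t)"

end

theory Submission
  imports Defs "HOL-Probability.Distributions"
begin

text \<open>
  Write \<open>\<psi>\<close> for the slice of \<open>\<phi>\<close> seen from the point \<open>p\<close>. It is the same at all preimages of \<open>p\<close>: for
  the varying triples by hypothesis, and for the others because \<open>F\<^sub>1\<close> preserves the fixed argument
  (\<open>slice_Sk_const\<close>). In the homogeneous coordinates
  \<open>(1 - x, x - y, y)\<close> of the triangle the branches are the nonnegative matrices \<open>F\<^sub>1\<^sup>k F\<^sub>0\<close>. For each of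
  the listed triples one coordinate of \<open>F\<^sub>1\<^sup>k F\<^sub>0 v\<close> does not depend on \<open>k\<close>, and applying \<open>F\<^sub>1\<close> adds
  just this coordinate to the coordinate sum. Hence \<open>d\<^sub>k = D (k + l)\<close> with \<open>j = 1 / D\<^sup>3\<close>, and \<open>h = 1 / (k + l)\<close>
  at the \<open>k\<close>-th preimage (\<open>good_branch\<close>, \<open>h_fun_Sk\<close>), so that the transfer operator at \<open>p\<close> equals
  \<open>j\<close> times the sum over \<open>k\<close> of \<open>(k + l)\<^sup>-\<^sup>2 \<integral> exp (- s / (k + l)) \<psi> s dm(s)\<close>.

  Two classical integrals turn this sum into the two right-hand sides. The function
  \<open>(k + l)\<^sup>-\<^sup>2 exp (- s / (k + l))\<close> is the Laplace transform in \<open>t\<close> of \<open>t J\<^sub>1(2 sqrt (s t)) / sqrt (s t)\<close>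
  at \<open>k + l\<close>, and summing the geometric series of the \<open>exp (- k t)\<close> produces the weight \<open>t / (exp t - 1)\<close>;
  this is the Bessel formula. The Laplace transform of \<open>t L\<^sub>k\<^sup>1(t)\<close> at \<open>\<nu>\<close> is
  \<open>(k + 1) (1 - 1 / \<nu>)\<^sup>k / \<nu>\<^sup>2\<close>, and summing these against \<open>s\<^sup>k exp (- s) / (k + 1)!\<close> gives back
  \<open>\<nu>\<^sup>-\<^sup>2 exp (- s / \<nu>)\<close>; this is the Laguerre formula.

  The difficulty is to justify the interchanges, since each integral is only assumed to exist separately
  and \<open>\<psi>\<close> may change sign. What saves the argument is that \<open>J\<^sub>1(2 sqrt (s t)) / sqrt (s t) \<cdot> \<psi> s\<close>
  is integrable for \<^emph>\<open>every\<close> \<open>t > 0\<close>. The zeros in \<open>s\<close> of the Bessel factor move with \<open>t\<close>, so after averaging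
  over \<open>t\<close> its modulus is comparable to its envelope \<open>(1 + s) powr (- 3 / 4)\<close>. To keep the average under
  control \<open>t\<close> is restricted to a set of nearly full measure on which the integrals stay bounded, and
  Tonelli's theorem shows that \<open>(1 + s) powr (- 3 / 4) \<psi> s\<close> is integrable
  (\<open>decay_integrable_if_bessel_integrable\<close>). With this single bound all double integrals and double sums
  converge absolutely: the exponent \<open>3 / 4\<close> is less than \<open>1\<close>, which leaves the convergent series of
  \<open>(k + 1) powr (- 5 / 4)\<close> when \<open>(k + l)\<^sup>-\<^sup>2 exp (- s / (k + l))\<close> is compared with the weight. The envelope
  and the lower bound for the average come from energy identities for Bessel's differential equation, without
  asymptotic expansions (\<open>energy_deriv\<close>, \<open>virial_deriv\<close>).
\<close>

section \<open>The Bessel kernel and its oscillation\<close>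

text \<open>The coefficients of \<open>J\<^sub>1(2 sqrt u) / sqrt u\<close>, which is an entire function of \<open>u\<close>.\<close>
definition bk_coeff :: "nat \<Rightarrow> real" where
  "bk_coeff n = (-1) ^ n / (fact n * fact (n + 1))"

definition bessel_kernel :: "real \<Rightarrow> real" where
  "bessel_kernel u = (\<Sum>n. bk_coeff n * u ^ n)"

definition bessel_kernel' :: "real \<Rightarrow> real" where
  "bessel_kernel' u = (\<Sum>n. diffs bk_coeff n * u ^ n)"

lemma abs_bk_coeff_le: "\<bar>bk_coeff n\<bar> \<le> inverse (fact n)"
proof -
  have "\<bar>bk_coeff n\<bar> = inverse (fact n) * inverse (fact (n + 1))"
    by (simp add: bk_coeff_def abs_mult power_abs field_simps)
  also have "\<dots> \<le> inverse (fact n) * 1"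
    by (intro mult_left_mono) (auto intro!: inverse_le_1_iff[THEN iffD2] fact_ge_1 simp del: fact_Suc)
  finally show ?thesis by simp
qed

lemma summable_norm_bk: "summable (\<lambda>n. norm (bk_coeff n * u ^ n))"
proof (rule summable_comparison_test')
  show "summable (\<lambda>n. inverse (fact n) * \<bar>u\<bar> ^ n)" by (rule summable_exp)
  show "norm (norm (bk_coeff n * u ^ n)) \<le> inverse (fact n) * \<bar>u\<bar> ^ n" if "n \<ge> 0" for n
    using abs_bk_coeff_le[of n] by (simp add: abs_mult power_abs mult_right_mono)
qed

lemma summable_bk: "summable (\<lambda>n. bk_coeff n * u ^ n)"
  by (rule summable_norm_cancel) (rule summable_norm_bk)

lemma bessel_kernel_has_derivative:
  "(bessel_kernel has_real_derivative bessel_kernel' u) (at u)"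
  unfolding bessel_kernel_def[abs_def] bessel_kernel'_def
  by (rule termdiffs_strong_converges_everywhere) (rule summable_bk)

text \<open>This is the differential equation \<open>u G'' + 2 G' + G = 0\<close>, solved for the second derivative:
  comparing coefficients, it is the recursion \<open>(n + 1) (n + 2) c\<^sub>n\<^sub>+\<^sub>1 + c\<^sub>n = 0\<close>.\<close>
lemma bessel_kernel'_has_derivative:
  assumes "u > 0"
  shows "(bessel_kernel' has_real_derivative - (2 * bessel_kernel' u + bessel_kernel u) / u) (at u)"
proof -
  define G2 where "G2 = (\<Sum>n. diffs (diffs bk_coeff) n * u ^ n)"
  have sm1: "\<And>y. summable (\<lambda>n. diffs bk_coeff n * y ^ n)"
    by (rule termdiff_converges_all) (rule summable_bk)
  have sm2: "summable (\<lambda>n. diffs (diffs bk_coeff) n * u ^ n)"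
    by (rule termdiff_converges_all) (rule sm1)
  have d: "(bessel_kernel' has_real_derivative G2) (at u)"
    unfolding bessel_kernel'_def[abs_def] G2_def
    by (rule termdiffs_strong_converges_everywhere) (rule sm1)
  have "(\<lambda>n. u * (diffs (diffs bk_coeff) n * u ^ n)) sums (u * G2)"
    unfolding G2_def by (intro sums_mult summable_sums sm2)
  then have "(\<lambda>n. real (Suc n) * diffs bk_coeff (Suc n) * u ^ Suc n) sums (u * G2)"
    by (simp add: diffs_def[of "diffs bk_coeff"] mult_ac)
  then have s2: "(\<lambda>n. real n * diffs bk_coeff n * u ^ n) sums (u * G2)"
    using sums_Suc_iff[of "\<lambda>n. real n * diffs bk_coeff n * u ^ n" "u * G2"] by simp
  have s1: "(\<lambda>n. 2 * (diffs bk_coeff n * u ^ n)) sums (2 * bessel_kernel' u)"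
    unfolding bessel_kernel'_def by (intro sums_mult summable_sums sm1)
  have s0: "(\<lambda>n. bk_coeff n * u ^ n) sums bessel_kernel u"
    unfolding bessel_kernel_def by (intro summable_sums summable_bk)
  have rec: "real n * diffs bk_coeff n + 2 * diffs bk_coeff n + bk_coeff n = 0" for n
  proof -
    have "bk_coeff n = - ((real n + 1) * (real n + 2)) * bk_coeff (Suc n)"
      by (simp add: bk_coeff_def divide_simps) (simp add: algebra_simps)
    then show ?thesis by (simp add: diffs_def algebra_simps)
  qed
  have "(\<lambda>n. real n * diffs bk_coeff n * u ^ n + 2 * (diffs bk_coeff n * u ^ n) + bk_coeff n * u ^ n)
      sums (u * G2 + 2 * bessel_kernel' u + bessel_kernel u)"
    by (intro sums_add s2 s1 s0)
  moreover have "real n * diffs bk_coeff n * u ^ n + 2 * (diffs bk_coeff n * u ^ n) + bk_coeff n * u ^ n = 0" for n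
    using arg_cong[OF rec[of n], of "\<lambda>z. z * u ^ n"] by (simp add: algebra_simps)
  ultimately have "(\<lambda>n. 0::real) sums (u * G2 + 2 * bessel_kernel' u + bessel_kernel u)" by simp
  then have "u * G2 + 2 * bessel_kernel' u + bessel_kernel u = 0"
    using sums_unique2 sums_zero by blast
  then have "G2 = - (2 * bessel_kernel' u + bessel_kernel u) / u"
    using assms by (simp add: field_simps)
  with d show ?thesis by simp
qed

lemma bessel_J1_eq_kernel:
  assumes "u > 0"
  shows "bessel_J1 (2 * sqrt u) / sqrt u = bessel_kernel u"
proof -
  have "bessel_J1 (2 * sqrt u) = (\<Sum>n. sqrt u * (bk_coeff n * u ^ n))"
    unfolding bessel_J1_def bk_coeff_def using assms
    by (intro suminf_cong) (simp add: power_mult)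
  also have "\<dots> = sqrt u * bessel_kernel u"
    unfolding bessel_kernel_def by (rule suminf_mult) (rule summable_bk)
  finally show ?thesis using assms by simp
qed

lemma bessel_kernel_0: "bessel_kernel 0 = 1"
  unfolding bessel_kernel_def by (subst powser_zero) (simp add: bk_coeff_def)

lemma continuous_bessel_kernel: "continuous_on S bessel_kernel"
  using bessel_kernel_has_derivative DERIV_isCont continuous_at_imp_continuous_on by blast

lemma borel_measurable_bessel_kernel [measurable]: "bessel_kernel \<in> borel_measurable borel"
  by (intro borel_measurable_continuous_onI continuous_bessel_kernel)

text \<open>The substitution \<open>u = x\<^sup>2\<close> makes the oscillation uniform: \<open>bessel_radial x\<close> is \<open>J\<^sub>1(2 x) / x\<close>, and
  \<open>w = x powr (3 / 2) * bessel_radial x\<close> satisfies the perturbed oscillator equation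
  \<open>w'' + (4 - 3 / (4 x\<^sup>2)) w = 0\<close>.\<close>
definition bessel_radial :: "real \<Rightarrow> real" where "bessel_radial x = bessel_kernel (x\<^sup>2)"
definition bessel_radial' :: "real \<Rightarrow> real" where "bessel_radial' x = 2 * x * bessel_kernel' (x\<^sup>2)"

lemma bessel_radial_deriv: "(bessel_radial has_real_derivative bessel_radial' x) (at x)"
proof -
  have "((\<lambda>x. bessel_kernel (x\<^sup>2)) has_real_derivative bessel_kernel' (x\<^sup>2) * (2 * x)) (at x)"
    by (rule DERIV_chain2[OF bessel_kernel_has_derivative]) (auto intro!: derivative_eq_intros)
  then show ?thesis unfolding bessel_radial_def[abs_def] bessel_radial'_def by (simp add: mult_ac)
qed

lemma bessel_radial'_deriv:
  assumes "x > 0"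
  shows "(bessel_radial' has_real_derivative (- 3 * bessel_radial' x / x - 4 * bessel_radial x)) (at x)"
proof -
  have 1: "((\<lambda>x. bessel_kernel' (x\<^sup>2)) has_real_derivative
      (- (2 * bessel_kernel' (x\<^sup>2) + bessel_kernel (x\<^sup>2)) / x\<^sup>2) * (2 * x)) (at x)"
    by (rule DERIV_chain2[OF bessel_kernel'_has_derivative]) (use assms in \<open>auto intro!: derivative_eq_intros\<close>)
  show ?thesis unfolding bessel_radial'_def[abs_def]
    by (rule derivative_eq_intros 1 refl)+ (use assms in \<open>simp add: bessel_radial_def field_simps power2_eq_square\<close>)
qed

text \<open>The oscillator energy \<open>w'\<^sup>2 + (4 - 3 / (4 x\<^sup>2)) w\<^sup>2\<close> of \<open>w = x powr (3 / 2) * bessel_radial x\<close>,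
  written out so that only integer powers of \<open>x\<close> occur.\<close>
definition energy :: "real \<Rightarrow> real" where
  "energy x = x^3 * (4 * (bessel_radial x)\<^sup>2 + (bessel_radial' x)\<^sup>2) + 3 * x\<^sup>2 * bessel_radial x * bessel_radial' x + 3/2 * x * (bessel_radial x)\<^sup>2"

text \<open>The energy changes only through the potential, whose derivative \<open>3 / (2 x\<^sup>3)\<close> multiplies \<open>w\<^sup>2\<close>.
  The energy is therefore increasing, and its relative growth rate is integrable at infinity.\<close>
lemma energy_deriv:
  assumes "x > 0"
  shows "(energy has_real_derivative 3/2 * (bessel_radial x)\<^sup>2) (at x)"
  unfolding energy_def[abs_def]
  by (rule derivative_eq_intros bessel_radial_deriv bessel_radial'_deriv assms refl)+
     (use assms in \<open>simp add: field_simps power2_eq_square power3_eq_cube\<close>)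

text \<open>The product \<open>w w'\<close> for \<open>w = x powr (3 / 2) * bessel_radial x\<close>.\<close>
definition virial :: "real \<Rightarrow> real" where
  "virial x = x^3 * bessel_radial x * bessel_radial' x + 3/2 * x\<^sup>2 * (bessel_radial x)\<^sup>2"

text \<open>The virial identity: the derivative of \<open>w w'\<close> is kinetic minus potential energy. Since \<open>w w'\<close> is
  bounded, on long intervals the potential energy \<open>4 w\<^sup>2\<close> carries half of the total energy on average, and
  so \<open>bessel_radial\<close> cannot be small most of the time.\<close>
lemma virial_deriv:
  assumes "x > 0"
  shows "(virial has_real_derivative energy x - 8 * x^3 * (bessel_radial x)\<^sup>2 + 3/2 * x * (bessel_radial x)\<^sup>2) (at x)"
  unfolding virial_def[abs_def]
  by (rule derivative_eq_intros bessel_radial_deriv bessel_radial'_deriv assms refl)+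
     (use assms in \<open>simp add: energy_def field_simps power2_eq_square power3_eq_cube\<close>)

lemma energy_eq:
  assumes "x > 0"
  shows "energy x = (4 * x^3 - 3/4 * x) * (bessel_radial x)\<^sup>2 + x * (x * bessel_radial' x + 3/2 * bessel_radial x)\<^sup>2"
  unfolding energy_def by (simp add: algebra_simps power2_eq_square power3_eq_cube)

lemma energy_ge:
  assumes "x \<ge> 1"
  shows "13/4 * x^3 * (bessel_radial x)\<^sup>2 \<le> energy x"
proof -
  have "x \<le> x^3" using assms by (simp add: self_le_power)
  then have "13/4 * x^3 * (bessel_radial x)\<^sup>2 \<le> (4 * x^3 - 3/4 * x) * (bessel_radial x)\<^sup>2"
    by (intro mult_right_mono) auto
  moreover have "0 \<le> x * (x * bessel_radial' x + 3/2 * bessel_radial x)\<^sup>2" using assms by auto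
  ultimately show ?thesis using energy_eq[of x] assms by linarith
qed

lemma energy_mono:
  assumes "0 < x" "x \<le> y" shows "energy x \<le> energy y"
  using assms(2)
proof (rule DERIV_nonneg_imp_nondecreasing)
  fix z assume "x \<le> z" "z \<le> y"
  then show "\<exists>d. (energy has_real_derivative d) (at z) \<and> 0 \<le> d"
    using energy_deriv[of z] assms by (intro exI[of _ "3/2 * (bessel_radial z)\<^sup>2"]) auto
qed

text \<open>For \<open>x \<ge> 1\<close> the logarithmic derivative of the energy is at most \<open>(6 / 13) x\<^sup>-\<^sup>3\<close>, so multiplication with
  \<open>exp (1 / x\<^sup>2)\<close>, whose logarithmic derivative is \<open>- 2 x\<^sup>-\<^sup>3\<close>, gives a decreasing function.\<close>
lemma energy_le:
  assumes "1 \<le> x" shows "energy x \<le> energy 1 * exp 1"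
proof -
  have "energy x * exp (1 / x\<^sup>2) \<le> energy 1 * exp (1 / 1\<^sup>2)"
    using assms
  proof (rule DERIV_nonpos_imp_nonincreasing)
    fix z :: real assume z: "1 \<le> z" "z \<le> x"
    have "((\<lambda>x. energy x * exp (1 / x\<^sup>2)) has_real_derivative
       (3/2 * (bessel_radial z)\<^sup>2 - 2 / z^3 * energy z) * exp (1 / z\<^sup>2)) (at z)"
      using z by (auto intro!: derivative_eq_intros energy_deriv simp: field_simps power2_eq_square power3_eq_cube)
    moreover have "3/2 * (bessel_radial z)\<^sup>2 - 2 / z^3 * energy z \<le> 0"
    proof -
      have "2 / z^3 * (13/4 * z^3 * (bessel_radial z)\<^sup>2) \<le> 2 / z^3 * energy z"
        using energy_ge[OF z(1)] z by (intro mult_left_mono) auto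
      moreover have "2 / z^3 * (13/4 * z^3 * (bessel_radial z)\<^sup>2) = 13/2 * (bessel_radial z)\<^sup>2" using z by simp
      ultimately show ?thesis using zero_le_power2[of "bessel_radial z"] by linarith
    qed
    ultimately show "\<exists>d. ((\<lambda>x. energy x * exp (1 / x\<^sup>2)) has_real_derivative d) (at z) \<and> d \<le> 0"
      by (meson mult_nonpos_nonneg exp_ge_zero)
  qed
  moreover have "energy x * 1 \<le> energy x * exp (1 / x\<^sup>2)"
    using energy_ge[OF assms] assms
    by (intro mult_left_mono) (auto intro: order_trans[of 0 "13/4 * x^3 * (bessel_radial x)\<^sup>2"])
  ultimately show ?thesis by simp
qed

text \<open>The energy increases from \<open>0\<close> at the origin. If it still vanished at \<open>1\<close>, its derivative
  \<open>(3 / 2) bessel_radial\<^sup>2\<close> would vanish on the unit interval, against \<open>bessel_radial 0 = 1\<close>.\<close>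
lemma energy_1_pos: "energy 1 > 0"
proof (rule ccontr)
  assume "\<not> energy 1 > 0"
  moreover have "0 \<le> energy 1"
    using order_trans[OF _ energy_ge[of 1], of 0] by simp
  ultimately have e1: "energy 1 = 0" by simp
  have "isCont bessel_radial 0" using bessel_radial_deriv DERIV_isCont by blast
  then have tend: "(bessel_radial \<longlongrightarrow> 1) (at 0)"
    by (simp add: isCont_def bessel_radial_def bessel_kernel_0)
  have c0: "isCont (\<lambda>x. bessel_kernel (x\<^sup>2)) 0"
    using bessel_radial_deriv[of 0] DERIV_isCont unfolding bessel_radial_def[abs_def] by blast
  have "\<And>y. summable (\<lambda>n. diffs bk_coeff n * y ^ n)"
    by (rule termdiff_converges_all) (rule summable_bk)
  then have "(bessel_kernel' has_real_derivative (\<Sum>n. diffs (diffs bk_coeff) n * 0 ^ n)) (at 0)"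
    unfolding bessel_kernel'_def[abs_def] by (rule termdiffs_strong_converges_everywhere)
  then have "isCont bessel_kernel' 0" by (rule DERIV_isCont)
  then have c1: "isCont (\<lambda>x. bessel_kernel' (x\<^sup>2)) 0"
    by (intro isCont_o2[where g = bessel_kernel' and f = "\<lambda>x. x\<^sup>2"]) auto
  have cont: "isCont energy 0"
    unfolding energy_def[abs_def] bessel_radial'_def[abs_def] bessel_radial_def[abs_def]
    by (intro continuous_intros c0 c1)
  have e0: "energy 0 = 0" by (simp add: energy_def)
  have nn: "0 \<le> energy z" if "z > 0" for z
  proof (rule tendsto_upperbound)
    show "(energy \<longlongrightarrow> 0) (at_right 0)"
      using cont e0 by (simp add: isCont_def filterlim_at_split)
    show "\<forall>\<^sub>F i in at_right 0. energy i \<le> energy z"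
      using eventually_at_right_less[of 0] eventually_at_right_field[of "\<lambda>i. i < z"] that
      by (auto intro!: eventually_at_rightI[of 0 z] energy_mono)
    show "at_right (0::real) \<noteq> bot" by simp
  qed
  have z0: "energy z = 0" if "0 < z" "z \<le> 1" for z
    using nn[of z] energy_mono[of z 1] e1 that by simp
  have bz: "bessel_radial z = 0" if "0 < z" "z < 1" for z
  proof -
    have "((\<lambda>_. 0) has_real_derivative 3/2 * (bessel_radial z)\<^sup>2) (at z)"
    proof (rule has_field_derivative_transform_within_open[OF energy_deriv])
      show "open {0<..<1::real}" by simp
    qed (use that z0 in auto)
    then have "3/2 * (bessel_radial z)\<^sup>2 = 0" using DERIV_unique[OF _ DERIV_const] by blast
    then show ?thesis by simp
  qed
  have "(bessel_radial \<longlongrightarrow> 1) (at_right 0)" using tend by (simp add: filterlim_at_split)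
  moreover have "(bessel_radial \<longlongrightarrow> 0) (at_right 0)"
    by (rule tendsto_eventually) (auto intro!: eventually_at_rightI[of 0 1] bz)
  ultimately show False using tendsto_unique[of "at_right (0::real)" bessel_radial 1 0] by simp
qed

text \<open>The envelope of the oscillating Bessel kernel.\<close>
definition decay :: "real \<Rightarrow> real" where "decay s = (1 + s) powr (- 3 / 4)"

lemma decay_pos: "s \<ge> 0 \<Longrightarrow> decay s > 0"
  by (simp add: decay_def)

lemma decay_le_1: "s \<ge> 0 \<Longrightarrow> decay s \<le> 1"
  using powr_mono[of "-3/4" 0 "1 + s"] by (simp add: decay_def)

lemma decay_antimono: "0 \<le> s \<Longrightarrow> s \<le> t \<Longrightarrow> decay t \<le> decay s"
  unfolding decay_def by (intro powr_mono2') auto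

lemma borel_measurable_decay [measurable]: "decay \<in> borel_measurable borel"
  unfolding decay_def[abs_def] by measurable

lemma decay_sq: "s \<ge> 0 \<Longrightarrow> (decay s)\<^sup>2 = (1 + s) powr (- 3 / 2)"
  by (simp add: decay_def power2_eq_square flip: powr_add)

lemma powr_sq_neg: "x > 0 \<Longrightarrow> (x\<^sup>2) powr (- 3 / 2) = inverse (x ^ 3)" for x :: real
  using powr_powr[of x 2 "- 3 / 2"] powr_minus[of x 3] by simp

lemma decay_sq_le: "x > 0 \<Longrightarrow> (decay (x\<^sup>2))\<^sup>2 \<le> inverse (x ^ 3)"
  by (subst decay_sq, simp, subst powr_sq_neg[symmetric], simp, intro powr_mono2') auto

lemma decay_sq_ge: "x \<ge> 1 \<Longrightarrow> inverse (x ^ 3) \<le> 4 * (decay (x\<^sup>2))\<^sup>2"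
proof -
  assume x: "x \<ge> 1"
  have q: "(1/4::real) \<le> 2 powr (- 3 / 2)"
  proof -
    have "(2::real) powr (- 2) \<le> 2 powr (- 3 / 2)" by (intro powr_mono) auto
    moreover have "(2::real) powr (- 2) = 1 / 4" by (simp add: powr_minus powr_numeral)
    ultimately show ?thesis by simp
  qed
  have "(2 * x\<^sup>2) powr (- 3 / 2) \<le> (1 + x\<^sup>2) powr (- 3 / 2)"
    using x by (intro powr_mono2') (auto simp: one_le_power add_pos_nonneg)
  then have "2 powr (- 3 / 2) * inverse (x ^ 3) \<le> (decay (x\<^sup>2))\<^sup>2"
    using x powr_sq_neg[of x] decay_sq[of "x\<^sup>2"] powr_mult[of 2 "x\<^sup>2" "- 3 / 2"] by simp
  moreover have "1 / 4 * inverse (x ^ 3) \<le> 2 powr (- 3 / 2) * inverse (x ^ 3)"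
    using q x by (intro mult_right_mono) auto
  ultimately show ?thesis by simp
qed

text \<open>For \<open>u = x\<^sup>2 \<ge> 1\<close> this is the boundedness of the energy, which dominates \<open>x\<^sup>3 bessel_radial\<^sup>2\<close>;
  on the unit interval the kernel is bounded by continuity.\<close>
lemma bessel_kernel_bounded_by_decay:
  obtains B where "B > 0" "\<And>u. u \<ge> 0 \<Longrightarrow> \<bar>bessel_kernel u\<bar> \<le> B * decay u"
proof -
  have "bounded (bessel_kernel ` {0..1})"
    by (intro compact_imp_bounded compact_continuous_image continuous_bessel_kernel) auto
  then obtain C where C: "\<And>u. u \<in> {0..1} \<Longrightarrow> \<bar>bessel_kernel u\<bar> \<le> C"
    unfolding bounded_iff by (metis image_eqI real_norm_def)
  define B where "B = 4 * energy 1 * exp 1 + C / decay 1 + 2 * sqrt (energy 1 * exp 1)"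
  have C0: "C \<ge> 0" using C[of 0] by auto
  have d1: "decay 1 > 0" by (rule decay_pos) simp
  have B: "B > 0" "C / decay 1 \<le> B" "2 * sqrt (energy 1 * exp 1) \<le> B"
    using C0 d1 energy_1_pos by (auto simp: B_def add_pos_nonneg)
  have "\<bar>bessel_kernel u\<bar> \<le> B * decay u" if u: "u \<ge> 0" for u
  proof (cases "u \<le> 1")
    case True
    then have "\<bar>bessel_kernel u\<bar> \<le> C / decay 1 * decay 1" using C u d1 by simp
    also have "\<dots> \<le> B * decay u"
      using True u d1 C0 B by (intro mult_mono decay_antimono) auto
    finally show ?thesis .
  next
    case False
    define x where "x = sqrt u"
    have x: "x \<ge> 1" "u = x\<^sup>2" using False by (auto simp: x_def)
    have "13/4 * x^3 * (bessel_radial x)\<^sup>2 \<le> energy 1 * exp 1"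
      using energy_ge[OF x(1)] energy_le[OF x(1)] by simp
    then have "(x^3 * (bessel_radial x)\<^sup>2) * inverse (x ^ 3) \<le> (energy 1 * exp 1) * inverse (x^3)"
      using x energy_1_pos by (intro mult_right_mono) (auto intro: order_trans[of _ "13/4 * x^3 * (bessel_radial x)\<^sup>2"])
    also have "\<dots> \<le> (energy 1 * exp 1) * (4 * (decay u)\<^sup>2)"
      using decay_sq_ge[OF x(1)] energy_1_pos x by (intro mult_left_mono) auto
    also have "\<dots> = (2 * sqrt (energy 1 * exp 1) * decay u)\<^sup>2"
      using energy_1_pos by (simp add: power_mult_distrib)
    finally have "x^3 * (bessel_radial x)\<^sup>2 * inverse (x ^ 3) \<le> (2 * sqrt (energy 1 * exp 1) * decay u)\<^sup>2" .
    moreover have "x^3 * (bessel_radial x)\<^sup>2 * inverse (x ^ 3) = \<bar>bessel_radial x\<bar>\<^sup>2" using x(1) by (simp add: field_simps)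
    ultimately have "\<bar>bessel_radial x\<bar>\<^sup>2 \<le> (2 * sqrt (energy 1 * exp 1) * decay u)\<^sup>2" by simp
    then have "\<bar>bessel_radial x\<bar> \<le> 2 * sqrt (energy 1 * exp 1) * decay u"
      using energy_1_pos decay_pos[OF u] by (intro power2_le_imp_le[of "\<bar>bessel_radial x\<bar>"]) auto
    also have "\<dots> \<le> B * decay u" using B decay_pos[OF u] by (intro mult_right_mono) auto
    finally show ?thesis by (simp add: bessel_radial_def x)
  qed
  with B that show ?thesis by blast
qed

lemma virial_bound:
  assumes "x \<ge> 1" shows "2 * \<bar>virial x\<bar> \<le> energy 1 * exp 1"
proof -
  have vir: "virial x = x\<^sup>2 * bessel_radial x * (x * bessel_radial' x + 3/2 * bessel_radial x)"
    by (simp add: virial_def algebra_simps power2_eq_square power3_eq_cube)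
  define a b where "a = x * bessel_radial x" and "b = x * bessel_radial' x + 3/2 * bessel_radial x"
  have "2 * \<bar>a * b\<bar> \<le> a\<^sup>2 + b\<^sup>2"
    using zero_le_power2[of "\<bar>a\<bar> - \<bar>b\<bar>"] by (simp add: power2_diff abs_mult)
  then have "x * (2 * \<bar>a * b\<bar>) \<le> x * (a\<^sup>2 + b\<^sup>2)" using assms by (intro mult_left_mono) auto
  moreover have "\<bar>virial x\<bar> = x * \<bar>a * b\<bar>"
    using assms by (simp add: vir a_def b_def abs_mult power2_eq_square)
  moreover have "x * (a\<^sup>2 + b\<^sup>2) \<le> energy x"
  proof -
    have "x \<le> x^3" using assms by (simp add: self_le_power)
    then have "x^3 * (bessel_radial x)\<^sup>2 \<le> (4 * x^3 - 3/4 * x) * (bessel_radial x)\<^sup>2"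
      using assms by (intro mult_right_mono) auto
    moreover have "x * a\<^sup>2 = x^3 * (bessel_radial x)\<^sup>2" by (simp add: a_def power2_eq_square power3_eq_cube)
    ultimately show ?thesis using energy_eq[of x] assms by (simp add: b_def distrib_left)
  qed
  ultimately show ?thesis using energy_le[OF assms] by linarith
qed

text \<open>Integrating the virial identity over \<open>[\<rho>, 2 \<rho>]\<close>, rescaled to \<open>[1, 2]\<close>: the boundary terms are
  \<open>O(1 / \<rho>)\<close>, and the energy is bounded below by its value at \<open>1\<close>. So in the mean the square of the
  kernel is as large as its envelope permits.\<close>
lemma bessel_kernel_mean_square:
  obtains a R where "a > 0" "R \<ge> 1"
    "\<And>\<rho>. \<rho> \<ge> R \<Longrightarrow> a * (decay (\<rho>\<^sup>2))\<^sup>2 \<le> (LINT r:{1..2}|lborel. (bessel_kernel (\<rho>\<^sup>2 * r\<^sup>2))\<^sup>2)"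
proof -
  define a0 e0 where "a0 = energy 1" and "e0 = energy 1 * exp 1"
  \<comment> \<open>Beyond \<open>2 * e0 / a0\<close> the boundary terms are at most half of the energy \<open>a0\<close>.\<close>
  define R where "R = max 1 (2 * e0 / a0)"
  have a0: "a0 > 0" using energy_1_pos by (simp add: a0_def)
  have "a0 / 128 * (decay (\<rho>\<^sup>2))\<^sup>2 \<le> (LINT r:{1..2}|lborel. (bessel_kernel (\<rho>\<^sup>2 * r\<^sup>2))\<^sup>2)"
    if \<rho>: "\<rho> \<ge> R" for \<rho>
  proof -
    have \<rho>1: "\<rho> \<ge> 1" "2 * e0 / a0 \<le> \<rho>" using \<rho> by (auto simp: R_def)
    define q where "q r = energy (\<rho> * r) - 8 * (\<rho> * r)^3 * (bessel_radial (\<rho> * r))\<^sup>2 + 3/2 * (\<rho> * r) * (bessel_radial (\<rho> * r))\<^sup>2" for r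
    let ?g2 = "\<lambda>r. (bessel_kernel (\<rho>\<^sup>2 * r\<^sup>2))\<^sup>2"
    have g2: "?g2 r = (bessel_radial (\<rho> * r))\<^sup>2" for r by (simp add: bessel_radial_def power_mult_distrib)
    have F: "((\<lambda>r. a0 - q r) has_integral
        (a0 * 2 - virial (\<rho> * 2) / \<rho>) - (a0 * 1 - virial (\<rho> * 1) / \<rho>)) {1..2}"
    proof (rule fundamental_theorem_of_calculus)
      fix r :: real assume r: "r \<in> {1..2}"
      have "((\<lambda>r. virial (\<rho> * r)) has_real_derivative q r * \<rho>) (at r)"
        unfolding q_def
        by (rule DERIV_chain2[OF virial_deriv]) (use r \<rho>1 in \<open>auto intro!: derivative_eq_intros\<close>)
      then have "((\<lambda>r. a0 * r - virial (\<rho> * r) / \<rho>) has_real_derivative a0 * 1 - (q r * \<rho>) / \<rho>) (at r)"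
        by (intro DERIV_diff DERIV_cmult DERIV_ident DERIV_cdivide)
      then have "((\<lambda>r. a0 * r - virial (\<rho> * r) / \<rho>) has_real_derivative a0 - q r) (at r)"
        using \<rho>1 by simp
      then show "((\<lambda>r. a0 * r - virial (\<rho> * r) / \<rho>) has_vector_derivative a0 - q r) (at r within {1..2})"
        by (simp add: has_real_derivative_iff_has_vector_derivative has_vector_derivative_at_within)
    qed simp
    have cont: "continuous_on {1..2} ?g2"
      by (intro continuous_intros continuous_on_compose2[OF continuous_bessel_kernel[of UNIV]]) auto
    have si: "set_integrable lborel {1..2} ?g2"
      unfolding set_integrable_def
      using borel_integrable_compact[of "{1..2::real}" ?g2] cont
      by (simp add: indicator_def if_distrib[of "\<lambda>x. x * _"] cong: if_cong)
    have I: "(?g2 has_integral (LINT r:{1..2}|lborel. ?g2 r)) {1..2}"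
      using set_borel_integral_eq_integral[OF si] by (auto simp: has_integral_iff)
    have "(a0 * 2 - virial (\<rho> * 2) / \<rho>) - (a0 * 1 - virial (\<rho> * 1) / \<rho>) \<le> 64 * \<rho>^3 * (LINT r:{1..2}|lborel. ?g2 r)"
    proof (rule has_integral_le[OF F has_integral_mult_right[OF I]])
      fix r :: real assume r: "r \<in> {1..2}"
      have 1: "a0 \<le> energy (\<rho> * r)"
        unfolding a0_def using r \<rho>1 by (intro energy_mono) (auto intro: order_trans[OF _ mult_mono[of 1 \<rho> 1 r]])
      have "r^3 \<le> 2^3" using r by (intro power_mono) auto
      then have "\<rho>^3 * r^3 \<le> \<rho>^3 * 8" using \<rho>1 by (intro mult_left_mono) auto
      then have 2: "8 * (\<rho> * r)^3 * (bessel_radial (\<rho> * r))\<^sup>2 \<le> (64 * \<rho>^3) * (bessel_radial (\<rho> * r))\<^sup>2"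
        by (intro mult_right_mono) (auto simp: power_mult_distrib)
      have "0 \<le> 3/2 * (\<rho> * r) * (bessel_radial (\<rho> * r))\<^sup>2" using r \<rho>1 by auto
      with 1 2 show "a0 - q r \<le> 64 * \<rho>^3 * ?g2 r" unfolding q_def g2 by linarith
    qed
    moreover have "2 * \<bar>virial (\<rho> * 2)\<bar> \<le> e0" "2 * \<bar>virial (\<rho> * 1)\<bar> \<le> e0"
      unfolding e0_def using \<rho>1 by (auto intro!: virial_bound)
    then have "(virial (\<rho> * 2) - virial (\<rho> * 1)) / \<rho> \<le> e0 / \<rho>"
      using \<rho>1 by (intro divide_right_mono) auto
    moreover have "e0 / \<rho> \<le> a0 / 2" using \<rho>1 a0 by (simp add: field_simps)
    ultimately have "a0 / 2 \<le> 64 * \<rho>^3 * (LINT r:{1..2}|lborel. ?g2 r)"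
      unfolding diff_divide_distrib by linarith
    then have "a0 / 128 * inverse (\<rho>^3) \<le> (LINT r:{1..2}|lborel. ?g2 r)"
      using \<rho>1 by (simp add: field_simps)
    moreover have "a0 / 128 * (decay (\<rho>\<^sup>2))\<^sup>2 \<le> a0 / 128 * inverse (\<rho>^3)"
      using \<rho>1 a0 by (intro mult_left_mono decay_sq_le) auto
    ultimately show ?thesis by linarith
  qed
  moreover have "a0 / 128 > 0" "R \<ge> 1" using a0 by (auto simp: R_def)
  ultimately show ?thesis using that by blast
qed

section \<open>Integrability forced by the Bessel transform\<close>

text \<open>Passage from the mean square to the mean modulus, and from \<open>[1, 2]\<close> to a subset of almost
  full measure: on the removed set the square is at most \<open>(B decay)\<^sup>2\<close>, which for small \<open>\<delta>\<close> costs at most half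
  of the mean square, and on \<open>E\<close> the square is at most \<open>B decay\<close> times the modulus.\<close>
lemma bessel_kernel_mean_on_large_subset:
  obtains c \<delta> R where "c > 0" "\<delta> > 0"
    "\<And>E s. E \<in> sets lborel \<Longrightarrow> E \<subseteq> {1..2} \<Longrightarrow> measure lborel ({1..2} - E) \<le> \<delta> \<Longrightarrow> s \<ge> R \<Longrightarrow>
       ennreal (c * decay s) \<le> (\<integral>\<^sup>+r. indicator E r * ennreal \<bar>bessel_kernel (s * r\<^sup>2)\<bar> \<partial>lborel)"
proof -
  obtain B where B: "B > 0" "\<And>u. u \<ge> 0 \<Longrightarrow> \<bar>bessel_kernel u\<bar> \<le> B * decay u"
    using bessel_kernel_bounded_by_decay by blast
  obtain a R where a: "a > 0" "R \<ge> 1"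
    "\<And>\<rho>. \<rho> \<ge> R \<Longrightarrow> a * (decay (\<rho>\<^sup>2))\<^sup>2 \<le> (LINT r:{1..2}|lborel. (bessel_kernel (\<rho>\<^sup>2 * r\<^sup>2))\<^sup>2)"
    using bessel_kernel_mean_square by blast
  \<comment> \<open>\<open>\<delta>\<close> is chosen so that removing a set of measure \<open>\<delta>\<close> loses at most half of the mean square.\<close>
  define \<delta> c where "\<delta> = a / (2 * B\<^sup>2)" and "c = a / (2 * B)"
  have "ennreal (c * decay s) \<le> (\<integral>\<^sup>+r. indicator E r * ennreal \<bar>bessel_kernel (s * r\<^sup>2)\<bar> \<partial>lborel)"
    if E: "E \<in> sets lborel" "E \<subseteq> {1..2}" "measure lborel ({1..2} - E) \<le> \<delta>" and s: "s \<ge> R\<^sup>2" for E s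
  proof -
    define A where "A = {1..2} - E"
    have [measurable]: "E \<in> sets borel" "A \<in> sets borel" using E by (auto simp: A_def)
    have s0: "s \<ge> 0" using s by (meson order_trans zero_le_power2)
    have d0: "decay s > 0" using decay_pos[OF s0] .
    let ?k = "\<lambda>r. bessel_kernel (s * r\<^sup>2)"
    have kb: "\<bar>?k r\<bar> \<le> B * decay s" if "r \<in> {1..2}" for r
    proof -
      have "s * 1 \<le> s * r\<^sup>2" using s0 that by (intro mult_left_mono one_le_power) auto
      then have "decay (s * r\<^sup>2) \<le> decay s" using s0 by (intro decay_antimono) auto
      then have "B * decay (s * r\<^sup>2) \<le> B * decay s" using B by simp
      with B(2)[of "s * r\<^sup>2"] s0 show ?thesis by simp
    qed
    have fin: "emeasure lborel S < \<infinity>" if "S \<subseteq> {1..2}" "S \<in> sets borel" for S :: "real set"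
    proof -
      have "emeasure lborel S \<le> emeasure lborel {1..2::real}" using that by (intro emeasure_mono) auto
      then show ?thesis by (auto simp: less_top[symmetric] top_unique)
    qed
    have int: "integrable lborel (\<lambda>r. indicator S r * f r)"
      if "S \<subseteq> {1..2}" "S \<in> sets borel" "f \<in> borel_measurable borel" "\<And>r. r \<in> {1..2} \<Longrightarrow> \<bar>f r\<bar> \<le> C"
      for S :: "real set" and f :: "real \<Rightarrow> real" and C
    proof (rule Bochner_Integration.integrable_bound)
      show "integrable lborel (\<lambda>r. C * indicator S r :: real)" using fin[OF that(1,2)] that by auto
      show "(\<lambda>r. indicator S r * f r) \<in> borel_measurable lborel" using that by measurable
      show "AE r in lborel. norm (indicator S r * f r) \<le> norm (C * indicator S r)"
        using that by (intro AE_I2) (force simp: indicator_def)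
    qed
    have sqb: "\<bar>(?k r)\<^sup>2\<bar> \<le> B * decay s * \<bar>?k r\<bar>" if "r \<in> {1..2}" for r
      using mult_right_mono[OF kb[OF that], of "\<bar>?k r\<bar>"] by (simp add: power2_eq_square abs_mult flip: abs_mult)
    have sqb2: "\<bar>(?k r)\<^sup>2\<bar> \<le> (B * decay s)\<^sup>2" if "r \<in> {1..2}" for r
      using kb[OF that] by (simp add: abs_le_square_iff[symmetric])
    have i1: "integrable lborel (\<lambda>r. indicator E r * (?k r)\<^sup>2)"
      by (rule int[where C = "(B * decay s)\<^sup>2"]) (use E sqb2 in auto)
    have i2: "integrable lborel (\<lambda>r. indicator A r * (?k r)\<^sup>2)"
      by (rule int[where C = "(B * decay s)\<^sup>2"]) (use sqb2 in \<open>auto simp: A_def\<close>)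
    have i3: "integrable lborel (\<lambda>r. indicator E r * \<bar>?k r\<bar>)"
      by (rule int[where C = "B * decay s"]) (use E kb in auto)
    have "sqrt s \<ge> R" using s a by (simp add: real_le_rsqrt)
    from a(3)[OF this] have "a * (decay s)\<^sup>2 \<le> (LINT r|lborel. indicator {1..2} r * (?k r)\<^sup>2)"
      using s0 by (simp add: set_lebesgue_integral_def)
    also have "\<dots> = (LINT r|lborel. indicator E r * (?k r)\<^sup>2 + indicator A r * (?k r)\<^sup>2)"
      using E by (intro Bochner_Integration.integral_cong) (auto simp: A_def indicator_def)
    also have "\<dots> = (LINT r|lborel. indicator E r * (?k r)\<^sup>2) + (LINT r|lborel. indicator A r * (?k r)\<^sup>2)"
      by (rule Bochner_Integration.integral_add[OF i1 i2])
    also have "(LINT r|lborel. indicator A r * (?k r)\<^sup>2) \<le> (LINT r|lborel. (B * decay s)\<^sup>2 * indicator A r)"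
    proof (rule integral_mono[OF i2])
      show "integrable lborel (\<lambda>r. (B * decay s)\<^sup>2 * indicator A r :: real)"
        using fin[of A] by (auto simp: A_def)
      show "indicator A r * (?k r)\<^sup>2 \<le> (B * decay s)\<^sup>2 * indicator A r" for r
        using sqb2[of r] by (auto simp: A_def indicator_def)
    qed
    also have "\<dots> = (B * decay s)\<^sup>2 * measure lborel A" by simp
    also have "\<dots> \<le> (B * decay s)\<^sup>2 * \<delta>" using E by (intro mult_left_mono) (auto simp: A_def)
    also have "\<dots> = a / 2 * (decay s)\<^sup>2" using B by (simp add: \<delta>_def power_mult_distrib)
    also have "(LINT r|lborel. indicator E r * (?k r)\<^sup>2) \<le> (LINT r|lborel. (B * decay s) * (indicator E r * \<bar>?k r\<bar>))"
      by (rule integral_mono[OF i1 integrable_mult_right[OF i3]])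
         (use E sqb in \<open>auto simp: indicator_def\<close>)
    also have "\<dots> = B * decay s * (LINT r|lborel. indicator E r * \<bar>?k r\<bar>)" by simp
    finally have "a / 2 * (decay s)\<^sup>2 \<le> B * decay s * (LINT r|lborel. indicator E r * \<bar>?k r\<bar>)" by simp
    then have "c * decay s \<le> (LINT r|lborel. indicator E r * \<bar>?k r\<bar>)"
      using d0 B by (simp add: c_def field_simps power2_eq_square)
    then have "ennreal (c * decay s) \<le> ennreal (LINT r|lborel. indicator E r * \<bar>?k r\<bar>)"
      by (rule ennreal_leI)
    also have "\<dots> = (\<integral>\<^sup>+r. ennreal (indicator E r * \<bar>?k r\<bar>) \<partial>lborel)"
      by (rule nn_integral_eq_integral[symmetric, OF i3]) auto
    also have "\<dots> = (\<integral>\<^sup>+r. indicator E r * ennreal \<bar>?k r\<bar> \<partial>lborel)"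
      by (intro nn_integral_cong) (auto simp: indicator_def)
    finally show ?thesis .
  qed
  moreover have "c > 0" "\<delta> > 0" using a B by (auto simp: c_def \<delta>_def)
  ultimately show ?thesis using that by blast
qed

text \<open>The hypothesis provides finite values \<open>\<Phi> r\<close> of the integral of the modulus, without any bound uniform
  in \<open>r\<close>. But the sets where \<open>\<Phi>\<close> exceeds \<open>n\<close> decrease to the empty set, so \<open>\<Phi>\<close> is bounded on
  a set \<open>E\<close> of almost full measure in \<open>[1, 2]\<close>. Integrating over \<open>E\<close> and exchanging the order of integration
  replaces the oscillating kernel by its mean over \<open>E\<close>, which is at least a multiple of the envelope for
  large \<open>s\<close>. For bounded \<open>s\<close> the integrability against one exponential suffices.\<close>
lemma decay_integrable_if_bessel_integrable:
  fixes \<mu> :: "real measure" and \<psi> :: "real \<Rightarrow> real"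
  assumes sf: "sigma_finite_measure \<mu>"
    and id: "(\<lambda>s. s) \<in> borel_measurable \<mu>"
    and nonneg: "AE s in \<mu>. s \<ge> 0"
    and meas: "\<psi> \<in> borel_measurable \<mu>"
    and exp_int: "integrable \<mu> (\<lambda>s. exp (- s * h) * \<psi> s)"
    and bk_int: "\<And>t. t > 0 \<Longrightarrow> integrable \<mu> (\<lambda>s. bessel_kernel (s * t) * \<psi> s)"
  shows "integrable \<mu> (\<lambda>s. decay s * \<psi> s)"
proof -
  interpret sigma_finite_measure \<mu> by (rule sf)
  interpret pair_sigma_finite \<mu> lborel ..
  have kernel_meas: "(\<lambda>r. ennreal \<bar>bessel_kernel (s * r\<^sup>2)\<bar>) \<in> borel_measurable lborel" for s
    by measurable
  note [measurable] = id meas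
  obtain c \<delta> R where c: "c > 0" "\<delta> > 0"
    "\<And>E s. E \<in> sets lborel \<Longrightarrow> E \<subseteq> {1..2} \<Longrightarrow> measure lborel ({1..2} - E) \<le> \<delta> \<Longrightarrow> s \<ge> R \<Longrightarrow>
       ennreal (c * decay s) \<le> (\<integral>\<^sup>+r. indicator E r * ennreal \<bar>bessel_kernel (s * r\<^sup>2)\<bar> \<partial>lborel)"
    using bessel_kernel_mean_on_large_subset by blast
  define \<Phi> where "\<Phi> r = (\<integral>\<^sup>+s. ennreal \<bar>bessel_kernel (s * r\<^sup>2) * \<psi> s\<bar> \<partial>\<mu>)" for r
  have [measurable]: "\<Phi> \<in> borel_measurable lborel"
    unfolding \<Phi>_def[abs_def] by measurable
  have \<Phi>_fin: "\<Phi> r < \<infinity>" if "r \<in> {1..2}" for r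
    using bk_int[of "r\<^sup>2"] that by (auto simp: \<Phi>_def integrable_iff_bounded)
  define A where "A n = {r \<in> {1..2}. of_nat n < \<Phi> r}" for n
  have A_sets [measurable]: "A n \<in> sets lborel" for n unfolding A_def by measurable
  have A_fin: "emeasure lborel (A n) \<noteq> \<infinity>" for n
  proof -
    have "emeasure lborel (A n) \<le> emeasure lborel {1..2::real}"
      by (intro emeasure_mono) (auto simp: A_def)
    then show ?thesis by (auto simp: top_unique)
  qed
  have "(\<lambda>n. measure lborel (A n)) \<longlonglongrightarrow> measure lborel (\<Inter>n. A n)"
  proof (rule Lim_measure_decseq)
    show "range A \<subseteq> sets lborel" using A_sets by blast
    show "decseq A"
      by (auto simp: decseq_def A_def intro: le_less_trans[rotated] of_nat_mono)
  qed (rule A_fin)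
  moreover have "(\<Inter>n. A n) = {}"
  proof -
    have "\<exists>n. r \<notin> A n" for r
    proof (cases "r \<in> {1..2}")
      case True
      then obtain n where "\<Phi> r \<le> of_nat n" using ennreal_Ex_less_of_nat[of "\<Phi> r"] \<Phi>_fin[OF True] by (auto intro: less_imp_le)
      then show ?thesis by (auto simp: A_def not_less)
    qed (auto simp: A_def)
    then show ?thesis by blast
  qed
  ultimately have "(\<lambda>n. measure lborel (A n)) \<longlonglongrightarrow> 0" by simp
  then have "eventually (\<lambda>n. measure lborel (A n) < \<delta>) sequentially"
    using c(2) by (rule order_tendstoD)
  then obtain n where n: "measure lborel (A n) < \<delta>" by (auto simp: eventually_sequentially)
  define E where "E = {1..2} - A n"
  have E_sets [measurable]: "E \<in> sets lborel"
    unfolding E_def by (rule sets.Diff[OF _ A_sets]) simp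
  have EA: "{1..2} - E = A n" by (auto simp: E_def A_def)
  define J where "J s = (\<integral>\<^sup>+r. indicator E r * ennreal \<bar>bessel_kernel (s * r\<^sup>2)\<bar> \<partial>lborel)" for s
  have J_meas: "J \<in> borel_measurable \<mu>" unfolding J_def[abs_def] by measurable
  have "(\<integral>\<^sup>+s. ennreal \<bar>\<psi> s\<bar> * J s \<partial>\<mu>)
      = (\<integral>\<^sup>+s. (\<integral>\<^sup>+r. indicator E r * ennreal \<bar>bessel_kernel (s * r\<^sup>2) * \<psi> s\<bar> \<partial>lborel) \<partial>\<mu>)"
    unfolding J_def
    by (intro nn_integral_cong, subst nn_integral_cmult[symmetric],
        intro borel_measurable_times_ennreal borel_measurable_indicator E_sets kernel_meas)
       (auto intro!: nn_integral_cong simp: abs_mult ennreal_mult mult_ac)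
  also have "\<dots> = (\<integral>\<^sup>+r. (\<integral>\<^sup>+s. indicator E r * ennreal \<bar>bessel_kernel (s * r\<^sup>2) * \<psi> s\<bar> \<partial>\<mu>) \<partial>lborel)"
    by (rule Fubini'[symmetric]) measurable
  also have "\<dots> = (\<integral>\<^sup>+r. indicator E r * \<Phi> r \<partial>lborel)"
    unfolding \<Phi>_def by (intro nn_integral_cong nn_integral_cmult) measurable
  also have "\<dots> \<le> (\<integral>\<^sup>+r. of_nat n * indicator {1..2::real} r \<partial>lborel)"
    by (intro nn_integral_mono) (auto simp: E_def A_def indicator_def not_less)
  also have "\<dots> = of_nat n" by (subst nn_integral_cmult_indicator) auto
  also have "of_nat n < (\<infinity>::ennreal)" by (simp add: of_nat_less_top)
  finally have J_fin: "(\<integral>\<^sup>+s. ennreal \<bar>\<psi> s\<bar> * J s \<partial>\<mu>) < \<infinity>" .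
  \<comment> \<open>\<open>M\<close> compensates the exponential factor on the bounded range \<open>s < R\<close>.\<close>
  define M where "M = exp (\<bar>R\<bar> * \<bar>h\<bar>)"
  have bound: "ennreal \<bar>decay s * \<psi> s\<bar> \<le> ennreal M * ennreal \<bar>exp (- s * h) * \<psi> s\<bar> + ennreal (1/c) * (ennreal \<bar>\<psi> s\<bar> * J s)"
    if s: "s \<ge> 0" for s
  proof (cases "s \<ge> R")
    case True
    have "ennreal (c * decay s) \<le> J s"
      unfolding J_def using n EA by (intro c(3)[OF E_sets _ _ True]) (auto simp: E_def)
    then have "ennreal \<bar>\<psi> s\<bar> * ennreal (c * decay s) \<le> ennreal \<bar>\<psi> s\<bar> * J s"
      by (rule mult_left_mono) simp
    then have "ennreal (1/c) * (ennreal \<bar>\<psi> s\<bar> * ennreal (c * decay s)) \<le> ennreal (1/c) * (ennreal \<bar>\<psi> s\<bar> * J s)"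
      by (rule mult_left_mono) simp
    moreover have "ennreal (1/c) * (ennreal \<bar>\<psi> s\<bar> * ennreal (c * decay s)) = ennreal \<bar>decay s * \<psi> s\<bar>"
      using c(1) decay_pos[OF s] by (simp add: abs_mult field_simps flip: ennreal_mult)
    ultimately show ?thesis by (simp add: add_increasing)
  next
    case False
    have "s * h \<le> \<bar>R\<bar> * \<bar>h\<bar>"
      using False s by (metis abs_ge_self abs_mult abs_of_nonneg mult_right_mono abs_ge_zero order_trans not_le less_imp_le)
    then have "1 \<le> M * exp (- s * h)" by (simp add: M_def flip: exp_add)
    then have "\<bar>\<psi> s\<bar> * 1 \<le> \<bar>\<psi> s\<bar> * (M * exp (- s * h))" by (intro mult_left_mono) auto
    moreover have "decay s * \<bar>\<psi> s\<bar> \<le> 1 * \<bar>\<psi> s\<bar>" using decay_le_1[OF s] by (intro mult_right_mono) auto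
    ultimately have "\<bar>decay s * \<psi> s\<bar> \<le> M * \<bar>exp (- s * h) * \<psi> s\<bar>"
      using decay_pos[OF s] by (simp add: abs_mult mult_ac)
    then have "ennreal \<bar>decay s * \<psi> s\<bar> \<le> ennreal M * ennreal \<bar>exp (- s * h) * \<psi> s\<bar>"
      by (simp add: M_def flip: ennreal_mult)
    then show ?thesis by (rule order_trans) simp
  qed
  have abs_meas: "(\<lambda>s. ennreal \<bar>exp (- s * h) * \<psi> s\<bar>) \<in> borel_measurable \<mu>"
    "(\<lambda>s. ennreal \<bar>\<psi> s\<bar>) \<in> borel_measurable \<mu>"
    by measurable
  have term_meas: "(\<lambda>s. ennreal M * ennreal \<bar>exp (- s * h) * \<psi> s\<bar>) \<in> borel_measurable \<mu>"
    "(\<lambda>s. ennreal (1/c) * (ennreal \<bar>\<psi> s\<bar> * J s)) \<in> borel_measurable \<mu>"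
    "(\<lambda>s. ennreal \<bar>\<psi> s\<bar> * J s) \<in> borel_measurable \<mu>"
    by (intro borel_measurable_times_ennreal borel_measurable_const abs_meas J_meas)+
  show ?thesis
  proof (rule integrableI_bounded)
    have "(\<integral>\<^sup>+s. ennreal (norm (decay s * \<psi> s)) \<partial>\<mu>)
       \<le> (\<integral>\<^sup>+s. ennreal M * ennreal \<bar>exp (- s * h) * \<psi> s\<bar> + ennreal (1/c) * (ennreal \<bar>\<psi> s\<bar> * J s) \<partial>\<mu>)"
      by (rule nn_integral_mono_AE) (use nonneg in eventually_elim, use bound in simp)
    also have "\<dots> = ennreal M * (\<integral>\<^sup>+s. ennreal \<bar>exp (- s * h) * \<psi> s\<bar> \<partial>\<mu>) + ennreal (1/c) * (\<integral>\<^sup>+s. ennreal \<bar>\<psi> s\<bar> * J s \<partial>\<mu>)"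
      unfolding nn_integral_add[OF term_meas(1,2)] nn_integral_cmult[OF abs_meas(1)]
        nn_integral_cmult[OF term_meas(3)] ..
    also have "\<dots> < \<infinity>"
      using exp_int J_fin by (auto simp: integrable_iff_bounded ennreal_mult_less_top)
    finally show "(\<integral>\<^sup>+s. ennreal (norm (decay s * \<psi> s)) \<partial>\<mu>) < \<infinity>" .
  qed measurable
qed

section \<open>Laplace transforms and the Planck weight\<close>

text \<open>The normalisation of the Erlang density; everything below integrates power series or polynomials
  termwise against it.\<close>
lemma has_bochner_integral_power_exp:
  fixes \<nu> :: real
  assumes "\<nu> > 0"
  shows "has_bochner_integral lborel (\<lambda>t. indicator {0<..} t * (t ^ k * exp (- \<nu> * t))) (fact k / \<nu> ^ (k + 1))"
proof (rule has_bochner_integral_nn_integral)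
  let ?c = "fact k / \<nu> ^ (k + 1)"
  have "(\<integral>\<^sup>+ t. ennreal (indicator {0<..} t * (t ^ k * exp (- \<nu> * t))) \<partial>lborel)
      = (\<integral>\<^sup>+ t. ennreal ?c * ennreal (erlang_density k \<nu> t * t ^ 0) \<partial>lborel)"
  proof (rule nn_integral_cong_AE)
    show "AE t in lborel. ennreal (indicator {0<..} t * (t ^ k * exp (- \<nu> * t)))
        = ennreal ?c * ennreal (erlang_density k \<nu> t * t ^ 0)"
      using AE_lborel_singleton[of "0::real"] assms
      by (auto elim!: eventually_mono simp: erlang_density_def indicator_def simp flip: ennreal_mult)
  qed
  also have "\<dots> = ennreal ?c * 1"
    using nn_integral_erlang_ith_moment[OF assms, of k 0] assms by (subst nn_integral_cmult) auto
  finally show "(\<integral>\<^sup>+ t. ennreal (indicator {0<..} t * (t ^ k * exp (- \<nu> * t))) \<partial>lborel) = ennreal ?c" by simp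
qed (use assms in \<open>auto simp: indicator_def\<close>)

lemma has_bochner_integral_laplace_bessel_kernel:
  fixes \<nu> s :: real
  assumes \<nu>: "\<nu> > 0"
  shows "has_bochner_integral lborel
     (\<lambda>t. indicator {0<..} t * (t * exp (- \<nu> * t) * bessel_kernel (s * t))) (exp (- s / \<nu>) / \<nu>\<^sup>2)"
proof -
  let ?f = "\<lambda>i t. (bk_coeff i * s ^ i) * (indicator {0<..} t * (t ^ Suc i * exp (- \<nu> * t)))"
  let ?g = "\<lambda>i t. \<bar>bk_coeff i * s ^ i\<bar> * (indicator {0<..} t * (t ^ Suc i * exp (- \<nu> * t)))"
  have co: "bk_coeff i * s ^ i * (fact (Suc i) / \<nu> ^ (Suc i + 1)) = (- s / \<nu>) ^ i /\<^sub>R fact i / \<nu>\<^sup>2" for i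
  proof -
    have "(- s / \<nu>) ^ i = (-1) ^ i * s ^ i / \<nu> ^ i"
      by (metis power_divide power_minus)
    then show ?thesis
      using \<nu> unfolding bk_coeff_def by (simp add: power2_eq_square field_simps del: fact_Suc)
  qed
  have hb: "has_bochner_integral lborel (?f i) ((- s / \<nu>) ^ i /\<^sub>R fact i / \<nu>\<^sup>2)" for i
    unfolding co[symmetric] by (intro has_bochner_integral_mult_right has_bochner_integral_power_exp \<nu>)
  have hg: "has_bochner_integral lborel (?g i) (\<bar>bk_coeff i * s ^ i\<bar> * (fact (Suc i) / \<nu> ^ (Suc i + 1)))" for i
    by (intro has_bochner_integral_mult_right has_bochner_integral_power_exp \<nu>)
  have norm_f: "norm (?f i t) = ?g i t" for i t
    by (auto simp: indicator_def abs_mult)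
  have gco: "\<bar>bk_coeff i * s ^ i\<bar> * (fact (Suc i) / \<nu> ^ (Suc i + 1)) = (\<bar>s\<bar> / \<nu>) ^ i /\<^sub>R fact i / \<nu>\<^sup>2" for i
    using arg_cong[OF co[of i], of abs] \<nu> by (simp add: abs_mult power_abs power_divide)
  have exp_series: "(\<lambda>i. x ^ i /\<^sub>R fact i / \<nu>\<^sup>2) sums (exp x / \<nu>\<^sup>2)" for x :: real
    by (intro sums_divide exp_converges)
  have pw: "(\<lambda>i. ?f i t) sums (indicator {0<..} t * (t * exp (- \<nu> * t) * bessel_kernel (s * t)))" for t
  proof -
    have "(\<lambda>i. (indicator {0<..} t * (t * exp (- \<nu> * t))) * (bk_coeff i * (s * t) ^ i))
       sums ((indicator {0<..} t * (t * exp (- \<nu> * t))) * bessel_kernel (s * t))"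
      unfolding bessel_kernel_def by (intro sums_mult summable_sums summable_bk)
    then show ?thesis by (simp add: power_mult_distrib mult_ac)
  qed
  have sm_norm: "summable (\<lambda>i. norm (?f i t))" for t
  proof -
    have "summable (\<lambda>i. (indicator {0<..} t * (\<bar>t\<bar> * exp (- \<nu> * t))) * norm (bk_coeff i * (s * t) ^ i))"
      by (intro summable_mult summable_norm_bk)
    then show ?thesis by (simp add: abs_mult power_mult_distrib power_abs mult_ac)
  qed
  have int_f: "integrable lborel (?f i)" for i using hb[of i] unfolding has_bochner_integral_iff by blast
  have sums_norm: "summable (\<lambda>i. LINT t|lborel. norm (?f i t))"
    unfolding norm_f has_bochner_integral_integral_eq[OF hg] gco
    using exp_series sums_summable by blast
  have eq: "(\<lambda>t. \<Sum>i. ?f i t) = (\<lambda>t. indicator {0<..} t * (t * exp (- \<nu> * t) * bessel_kernel (s * t)))"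
    using pw by (simp add: sums_iff)
  have "integrable lborel (\<lambda>t. \<Sum>i. ?f i t)"
    by (rule integrable_suminf[OF int_f _ sums_norm]) (use sm_norm in simp)
  moreover have "(\<lambda>i. integral\<^sup>L lborel (?f i)) sums (LINT t|lborel. (\<Sum>i. ?f i t))"
    by (rule sums_integral[OF int_f _ sums_norm]) (use sm_norm in simp)
  then have "(LINT t|lborel. (\<Sum>i. ?f i t)) = exp (- s / \<nu>) / \<nu>\<^sup>2"
    unfolding has_bochner_integral_integral_eq[OF hb] using exp_series sums_unique2 by blast
  ultimately show ?thesis unfolding eq by (simp add: has_bochner_integral_iff)
qed

lemma has_bochner_integral_laplace_laguerre:
  fixes \<nu> :: real
  assumes \<nu>: "\<nu> > 0"
  shows "has_bochner_integral lborel
     (\<lambda>t. indicator {0<..} t * (t * exp (- \<nu> * t) * laguerre 1 k t)) ((real k + 1) * (1 - 1 / \<nu>) ^ k / \<nu>\<^sup>2)"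
proof -
  let ?c = "\<lambda>i. (-1) ^ i * real ((k + 1) choose (k - i)) / fact i"
  have "has_bochner_integral lborel
     (\<lambda>t. \<Sum>i\<le>k. ?c i * (indicator {0<..} t * (t ^ Suc i * exp (- \<nu> * t))))
     (\<Sum>i\<le>k. ?c i * (fact (Suc i) / \<nu> ^ (Suc i + 1)))"
    by (intro has_bochner_integral_sum has_bochner_integral_mult_right has_bochner_integral_power_exp \<nu>)
  moreover have "(\<lambda>t. \<Sum>i\<le>k. ?c i * (indicator {0<..} t * (t ^ Suc i * exp (- \<nu> * t))))
      = (\<lambda>t. indicator {0<..} t * (t * exp (- \<nu> * t) * laguerre 1 k t))"
    unfolding laguerre_def by (simp add: sum_distrib_left mult_ac)
  moreover have "(\<Sum>i\<le>k. ?c i * (fact (Suc i) / \<nu> ^ (Suc i + 1))) = (real k + 1) * (1 - 1 / \<nu>) ^ k / \<nu>\<^sup>2"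
  proof -
    have "?c i * (fact (Suc i) / \<nu> ^ (Suc i + 1)) = (real k + 1) / \<nu>\<^sup>2 * (real (k choose i) * (- 1 / \<nu>) ^ i * 1 ^ (k - i))"
      if "i \<le> k" for i
    proof -
      have "(k + 1) choose (k - i) = Suc k choose Suc i"
        using binomial_symmetric[of "Suc i" "Suc k"] that by simp
      then have "real ((k + 1) choose (k - i)) * (real i + 1) = (real k + 1) * real (k choose i)"
        using arg_cong[OF Suc_times_binomial[of i k], of real] by (simp add: algebra_simps)
      moreover have "?c i * (fact (Suc i) / \<nu> ^ (Suc i + 1))
          = (-1) ^ i * (real ((k + 1) choose (k - i)) * (real i + 1)) / \<nu> ^ (Suc i + 1)"
        by (simp add: add.commute)
      ultimately have "?c i * (fact (Suc i) / \<nu> ^ (Suc i + 1)) = (-1) ^ i * ((real k + 1) * real (k choose i)) / \<nu> ^ (Suc i + 1)"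
        by simp
      also have "\<dots> = (real k + 1) / \<nu>\<^sup>2 * (real (k choose i) * (- 1 / \<nu>) ^ i * 1 ^ (k - i))"
        using \<nu> power_divide[of "- 1" \<nu> i] by (simp add: power2_eq_square mult_ac)
      finally show ?thesis .
    qed
    then have "(\<Sum>i\<le>k. ?c i * (fact (Suc i) / \<nu> ^ (Suc i + 1)))
       = (\<Sum>i\<le>k. (real k + 1) / \<nu>\<^sup>2 * (real (k choose i) * (- 1 / \<nu>) ^ i * 1 ^ (k - i)))"
      by (intro sum.cong) auto
    also have "\<dots> = (real k + 1) / \<nu>\<^sup>2 * (- 1 / \<nu> + 1) ^ k"
      unfolding binomial_ring[of "- 1 / \<nu>" 1 k] by (simp add: sum_distrib_left)
    finally show ?thesis by simp
  qed
  ultimately show ?thesis by simp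
qed

text \<open>Expansion of the weight \<open>t / (exp t - 1)\<close> into the geometric series of the \<open>t exp (- (n + 1) t)\<close>. The
  partial sums are the full integrand times \<open>1 - exp (- N t)\<close>, hence dominated by it; so the
  series may be integrated termwise as soon as the full integrand is integrable.\<close>
lemma sums_planck_integral:
  fixes F :: "real \<Rightarrow> real"
  assumes [measurable]: "F \<in> borel_measurable lborel"
    and int: "integrable lborel (\<lambda>t. indicator {0<..} t * (exp (- t * (l - 1)) * (t / (exp t - 1) * F t)))"
  shows "(\<lambda>n. LINT t|lborel. indicator {0<..} t * (t * exp (- (real n + l) * t) * F t)) sums
       (LINT t|lborel. indicator {0<..} t * (exp (- t * (l - 1)) * (t / (exp t - 1) * F t)))"
proof -
  let ?f = "\<lambda>n t. indicator {0<..} t * (t * exp (- (real n + l) * t) * F t)"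
  let ?g = "\<lambda>t. indicator {0<..} t * (exp (- t * (l - 1)) * (t / (exp t - 1) * F t))"
  have fac: "?f n t = ?g t * (1 - exp (- t)) * exp (- t) ^ n" for n t
  proof (cases "t > 0")
    case True
    then have "exp t - 1 > 0" by simp
    then have planck: "exp (- t * (l - 1)) * (t / (exp t - 1)) * (1 - exp (- t)) = t * exp (- l * t)"
    proof -
      have "1 - exp (- t) = (exp t - 1) / exp t" by (simp add: exp_minus field_simps)
      moreover have "exp (- t * (l - 1)) = exp t * exp (- l * t)"
        by (simp add: algebra_simps flip: exp_add)
      ultimately show ?thesis using \<open>exp t - 1 > 0\<close> by simp
    qed
    have "exp (- (real n + l) * t) = exp (- l * t) * exp (- t) ^ n"
      by (simp add: algebra_simps flip: exp_of_nat_mult exp_add)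
    then have "?f n t = (t * exp (- l * t)) * (exp (- t) ^ n * F t)" using True by simp
    also have "\<dots> = ?g t * (1 - exp (- t)) * exp (- t) ^ n"
      unfolding planck[symmetric] using True by (simp only: indicator_simps greaterThan_iff mult_ac)
    finally show ?thesis .
  qed simp
  have le1: "0 \<le> (1 - exp (- t)) * exp (- t) ^ n" "(1 - exp (- t)) * exp (- t) ^ n \<le> 1" if "t > 0" for t :: real and n
    using that by (auto intro!: mult_nonneg_nonneg mult_le_one power_le_one)
  have int_f: "integrable lborel (?f n)" for n
  proof (rule Bochner_Integration.integrable_bound[OF int])
    show "AE t in lborel. norm (?f n t) \<le> norm (?g t)"
    proof (intro AE_I2)
      fix t
      show "norm (?f n t) \<le> norm (?g t)"
      proof (cases "t > 0")
        case True
        have "norm (?f n t) = norm (?g t) * ((1 - exp (- t)) * exp (- t) ^ n)"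
          unfolding fac mult.assoc[of "?g t"] norm_mult[of "?g t"] using le1(1)[OF True, of n] by simp
        also have "\<dots> \<le> norm (?g t) * 1" using le1(2)[OF True] by (intro mult_left_mono) auto
        finally show ?thesis by simp
      qed simp
    qed
  qed measurable
  have part: "(\<Sum>n<N. ?f n t) = ?g t * (1 - exp (- t) ^ N)" for N t
  proof -
    have "(\<Sum>n<N. ?f n t) = ?g t * ((1 - exp (- t)) * (\<Sum>n<N. exp (- t) ^ n))"
      unfolding fac by (simp only: sum_distrib_left mult.assoc)
    also have "(1 - exp (- t)) * (\<Sum>n<N. exp (- t) ^ n) = 1 - exp (- t) ^ N"
      by (rule one_diff_power_eq[symmetric])
    finally show ?thesis .
  qed
  have "(\<lambda>N. LINT t|lborel. (\<Sum>n<N. ?f n t)) \<longlonglongrightarrow> (LINT t|lborel. ?g t)"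
  proof (rule integral_dominated_convergence[where w = "\<lambda>t. norm (?g t)"])
    show "AE t in lborel. (\<lambda>N. \<Sum>n<N. ?f n t) \<longlonglongrightarrow> ?g t"
    proof (intro AE_I2)
      fix t
      show "(\<lambda>N. \<Sum>n<N. ?f n t) \<longlonglongrightarrow> ?g t"
      proof (cases "t > 0")
        case True
        have "(\<lambda>N. ?g t * (1 - exp (- t) ^ N)) \<longlonglongrightarrow> ?g t * (1 - 0)"
          using True by (intro tendsto_intros LIMSEQ_power_zero) auto
        then show ?thesis unfolding part by simp
      qed simp
    qed
    show "AE t in lborel. norm (\<Sum>n<N. ?f n t) \<le> norm (?g t)" for N
    proof (intro AE_I2)
      fix t
      show "norm (\<Sum>n<N. ?f n t) \<le> norm (?g t)"
      proof (cases "t > 0")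
        case True
        then have "\<bar>1 - exp (- t) ^ N\<bar> \<le> 1" by (simp add: power_le_one)
        then have "norm (?g t) * \<bar>1 - exp (- t) ^ N\<bar> \<le> norm (?g t) * 1"
          by (intro mult_left_mono) auto
        then show ?thesis unfolding part norm_mult[of "?g t"] by (simp only: real_norm_def mult_1_right)
      qed simp
    qed
    show "integrable lborel (\<lambda>t. norm (?g t))" by (rule integrable_norm[OF int])
  qed measurable
  moreover have "(LINT t|lborel. (\<Sum>n<N. ?f n t)) = (\<Sum>n<N. LINT t|lborel. ?f n t)" for N
    by (rule Bochner_Integration.integral_sum) (rule int_f)
  ultimately show "(\<lambda>n. LINT t|lborel. ?f n t) sums (LINT t|lborel. ?g t)"
    by (simp add: sums_def)
qed

section \<open>Resummation over the branches\<close>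

text \<open>Fubini's theorem for the Laplace transform of the Bessel transform of \<open>\<psi>\<close>. The double integral
  converges absolutely because \<open>t decay (s t) \<le> (1 + t) decay s\<close>, which separates the variables.\<close>
lemma laplace_bessel_transform:
  fixes \<mu> :: "real measure" and \<psi> :: "real \<Rightarrow> real"
  assumes sf: "sigma_finite_measure \<mu>"
    and id: "(\<lambda>s. s) \<in> borel_measurable \<mu>"
    and nonneg: "AE s in \<mu>. s \<ge> 0"
    and meas: "\<psi> \<in> borel_measurable \<mu>"
    and decay_int: "integrable \<mu> (\<lambda>s. decay s * \<psi> s)"
    and \<nu>: "\<nu> > 0"
  shows "(LINT t|lborel. indicator {0<..} t * (t * exp (- \<nu> * t) * (LINT s|\<mu>. bessel_kernel (s * t) * \<psi> s)))
      = (LINT s|\<mu>. exp (- s / \<nu>) / \<nu>\<^sup>2 * \<psi> s)"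
proof -
  interpret sigma_finite_measure \<mu> by (rule sf)
  interpret pair_sigma_finite \<mu> lborel ..
  obtain B where B: "B > 0" "\<And>u. u \<ge> 0 \<Longrightarrow> \<bar>bessel_kernel u\<bar> \<le> B * decay u"
    using bessel_kernel_bounded_by_decay by blast
  let ?w = "\<lambda>t. indicator {0<..} t * ((1 + t) * exp (- \<nu> * t))"
  let ?f = "\<lambda>s t. indicator {0<..} t * (t * exp (- \<nu> * t) * bessel_kernel (s * t)) * \<psi> s"
  have w_int: "integrable lborel ?w"
  proof -
    have "integrable lborel (\<lambda>t. indicator {0<..} t * (t ^ 0 * exp (- \<nu> * t)) + indicator {0<..} t * (t ^ 1 * exp (- \<nu> * t)))"
      by (intro Bochner_Integration.integrable_add integrable.intros[OF has_bochner_integral_power_exp[OF \<nu>]])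
    then show ?thesis by (simp add: algebra_simps)
  qed
  have t_decay: "t * decay (s * t) \<le> (1 + t) * decay s" if "s \<ge> 0" "t > 0" for s t
  proof (cases "t \<ge> 1")
    case True
    have "s * 1 \<le> s * t" using that True by (intro mult_left_mono) auto
    then have "t * decay (s * t) \<le> t * decay s" using that by (intro mult_left_mono decay_antimono) auto
    also have "\<dots> \<le> (1 + t) * decay s" using that decay_pos[of s] by (intro mult_right_mono) auto
    finally show ?thesis .
  next
    case False
    have "(t * (1 + s)) powr (- 3 / 4) \<ge> (1 + s * t) powr (- 3 / 4)"
      using that False by (intro powr_mono2') (auto simp: algebra_simps add_pos_nonneg)
    then have "decay (s * t) \<le> t powr (- 3 / 4) * decay s"
      using that by (simp add: decay_def powr_mult)
    then have "t * decay (s * t) \<le> t * (t powr (- 3 / 4) * decay s)" using that by (intro mult_left_mono) auto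
    also have "t * (t powr (- 3 / 4) * decay s) = t powr (1 / 4) * decay s"
      using that powr_add[of t 1 "- 3 / 4"] by simp
    also have "\<dots> \<le> (1 + t) * decay s"
      using that False decay_pos[of s] powr_mono2[of "1/4" t 1] by (intro mult_right_mono) auto
    finally show ?thesis .
  qed
  have bound: "\<bar>?f s t\<bar> \<le> ?w t * (B * \<bar>decay s * \<psi> s\<bar>)" if "s \<ge> 0" for s t
  proof (cases "t > 0")
    case True
    have "t * \<bar>bessel_kernel (s * t)\<bar> \<le> t * (B * decay (s * t))" using B(2)[of "s * t"] that True by (intro mult_left_mono) auto
    also have "\<dots> \<le> B * ((1 + t) * decay s)" using t_decay[OF that True] B(1) by simp
    finally have "exp (- \<nu> * t) * \<bar>\<psi> s\<bar> * (t * \<bar>bessel_kernel (s * t)\<bar>) \<le> exp (- \<nu> * t) * \<bar>\<psi> s\<bar> * (B * ((1 + t) * decay s))"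
      by (intro mult_left_mono) auto
    then show ?thesis using True decay_pos[OF that] by (simp add: abs_mult mult_ac)
  qed simp
  note [measurable] = id meas
  have f_meas: "case_prod ?f \<in> borel_measurable (\<mu> \<Otimes>\<^sub>M lborel)" by measurable
  have row_int: "integrable lborel (?f s)" if "s \<ge> 0" for s
    using has_bochner_integral_laplace_bessel_kernel[OF \<nu>, of s]
    by (intro integrable_mult_left) (simp add: has_bochner_integral_iff)
  have int: "integrable (\<mu> \<Otimes>\<^sub>M lborel) (case_prod ?f)"
  proof (rule Fubini_integrable[OF f_meas])
    show "AE s in \<mu>. integrable lborel (\<lambda>t. case_prod ?f (s, t))"
      using nonneg by eventually_elim (use row_int in simp)
    show "integrable \<mu> (\<lambda>s. LINT t|lborel. norm (case_prod ?f (s, t)))"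
    proof (rule Bochner_Integration.integrable_bound)
      show "integrable \<mu> (\<lambda>s. (LINT t|lborel. ?w t) * (B * \<bar>decay s * \<psi> s\<bar>))"
        using decay_int by (intro integrable_mult_right integrable_abs)
      show "(\<lambda>s. LINT t|lborel. norm (case_prod ?f (s, t))) \<in> borel_measurable \<mu>"
        by measurable
      show "AE s in \<mu>. norm (LINT t|lborel. norm (case_prod ?f (s, t))) \<le> norm ((LINT t|lborel. ?w t) * (B * \<bar>decay s * \<psi> s\<bar>))"
        using nonneg
      proof eventually_elim
        case (elim s)
        have "(LINT t|lborel. norm (?f s t)) \<le> (LINT t|lborel. ?w t * (B * \<bar>decay s * \<psi> s\<bar>))"
          using row_int[OF elim] w_int bound[OF elim]
          by (intro integral_mono integrable_norm integrable_mult_left) auto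
        also have "\<dots> = (LINT t|lborel. ?w t) * (B * \<bar>decay s * \<psi> s\<bar>)" by simp
        finally have "(LINT t|lborel. norm (?f s t)) \<le> (LINT t|lborel. ?w t) * (B * \<bar>decay s * \<psi> s\<bar>)" .
        moreover have "0 \<le> (LINT t|lborel. norm (?f s t))" by simp
        ultimately show ?case unfolding case_prod_conv real_norm_def by linarith
      qed
    qed
  qed
  have "(LINT t|lborel. indicator {0<..} t * (t * exp (- \<nu> * t) * (LINT s|\<mu>. bessel_kernel (s * t) * \<psi> s)))
      = (LINT t|lborel. LINT s|\<mu>. ?f s t)"
  proof (rule Bochner_Integration.integral_cong[OF refl])
    fix t
    have "(\<lambda>s. ?f s t) = (\<lambda>s. (indicator {0<..} t * (t * exp (- \<nu> * t))) * (bessel_kernel (s * t) * \<psi> s))"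
      by (simp add: mult_ac fun_eq_iff)
    then show "indicator {0<..} t * (t * exp (- \<nu> * t) * (LINT s|\<mu>. bessel_kernel (s * t) * \<psi> s)) = (LINT s|\<mu>. ?f s t)"
      by (simp only: integral_mult_right_zero mult.assoc)
  qed
  also have "\<dots> = (LINT s|\<mu>. LINT t|lborel. ?f s t)"
    by (rule Fubini_integral[OF int])
  also have "\<dots> = (LINT s|\<mu>. exp (- s / \<nu>) / \<nu>\<^sup>2 * \<psi> s)"
    using has_bochner_integral_laplace_bessel_kernel[OF \<nu>]
    by (intro Bochner_Integration.integral_cong refl) (simp add: has_bochner_integral_iff)
  finally show ?thesis .
qed

lemma sums_swap_nonneg:
  fixes a :: "nat \<Rightarrow> nat \<Rightarrow> real"
  assumes nonneg: "\<And>n k. a n k \<ge> 0"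
    and rows: "\<And>n. (\<lambda>k. a n k) sums r n" and cols: "\<And>k. (\<lambda>n. a n k) sums c k"
    and r: "r sums R"
  shows "c sums R"
proof -
  have r0: "r n \<ge> 0" for n using rows nonneg by (metis sums_iff suminf_nonneg)
  have c0: "c k \<ge> 0" for k using cols nonneg by (metis sums_iff suminf_nonneg)
  have hr: "((\<lambda>k. a n k) has_sum r n) UNIV" for n by (rule sums_nonneg_imp_has_sum[OF rows nonneg])
  have hc: "((\<lambda>n. a n k) has_sum c k) UNIV" for k by (rule sums_nonneg_imp_has_sum[OF cols nonneg])
  have hR: "(r has_sum R) UNIV" by (rule sums_nonneg_imp_has_sum[OF r r0])
  have "(\<lambda>p. norm (case_prod a p)) summable_on (UNIV \<times> UNIV)"
  proof (subst Infinite_Sum.abs_summable_on_Sigma_iff, intro conjI ballI)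
    show "(\<lambda>k. norm (case_prod a (n, k))) summable_on UNIV" for n
      using hr[of n] nonneg by (simp add: has_sum_imp_summable)
    have "(\<Sum>\<^sub>\<infinity>k. norm (case_prod a (n, k))) = r n" for n
      using infsumI[OF hr[of n]] nonneg by simp
    then show "(\<lambda>n. norm (\<Sum>\<^sub>\<infinity>k. norm (case_prod a (n, k)))) summable_on UNIV"
      by (simp only: real_norm_def abs_of_nonneg[OF r0]) (rule has_sum_imp_summable[OF hR])
  qed
  then have sm: "(\<lambda>(n, k). a n k) summable_on (UNIV \<times> UNIV)" by (rule abs_summable_summable)
  have "(\<Sum>\<^sub>\<infinity>n. \<Sum>\<^sub>\<infinity>k. a n k) = (\<Sum>\<^sub>\<infinity>k. \<Sum>\<^sub>\<infinity>n. a n k)" by (rule infsum_swap_banach[OF sm])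
  then have eq: "infsum c UNIV = R"
    by (simp only: infsumI[OF hr] infsumI[OF hc] infsumI[OF hR])
  have "(\<lambda>(k, n). a n k) summable_on (UNIV \<times> UNIV)"
    using sm summable_on_swap[of "\<lambda>(n, k). a n k" UNIV UNIV] by simp
  then have "(\<lambda>k. infsum (\<lambda>n. a n k) UNIV) summable_on UNIV"
    by (rule summable_on_Sigma_banach)
  then have "c summable_on UNIV" by (simp only: infsumI[OF hc])
  then show ?thesis using eq has_sum_imp_sums has_sum_infsum by blast
qed

text \<open>From \<open>1 + s \<le> \<nu> (1 + s / \<nu>) \<le> \<nu> exp (s / \<nu>)\<close> one gets
  \<open>exp (- s / \<nu>) \<le> \<nu> powr (3 / 4) decay s\<close>; the remaining factor \<open>\<nu> powr (- 5 / 4)\<close> is summable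
  over \<open>\<nu> = n + l\<close>.\<close>
lemma planck_term_le_decay:
  assumes "l \<ge> 1" "s \<ge> 0"
  shows "exp (- s / (real n + l)) / (real n + l)\<^sup>2 \<le> decay s * (real (Suc n)) powr (- 5 / 4)"
proof -
  define \<nu> where "\<nu> = real n + l"
  have \<nu>: "\<nu> \<ge> real (Suc n)" "\<nu> \<ge> 1" using assms by (auto simp: \<nu>_def)
  have "1 + s \<le> \<nu> + s" using \<nu> by simp
  also have "\<dots> = \<nu> * (1 + s / \<nu>)" using \<nu> by (simp add: field_simps)
  also have "\<dots> \<le> \<nu> * exp (s / \<nu>)" using \<nu> by (intro mult_left_mono exp_ge_add_one_self) auto
  finally have "(\<nu> * exp (s / \<nu>)) powr (- 3 / 4) \<le> decay s"
    unfolding decay_def using assms by (intro powr_mono2') auto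
  moreover have "(\<nu> * exp (s / \<nu>)) powr (- 3 / 4) = \<nu> powr (- 3 / 4) * exp (- (3 / 4) * (s / \<nu>))"
    using \<nu> powr_mult[of \<nu> "exp (s / \<nu>)" "- 3 / 4"] by (simp add: exp_powr_real mult.commute)
  moreover have "0 \<le> s / \<nu>" using \<nu> assms by simp
  then have "exp (- s / \<nu>) \<le> exp (- (3 / 4) * (s / \<nu>))"
    unfolding exp_le_cancel_iff minus_divide_left[symmetric] by linarith
  then have "\<nu> powr (- 3 / 4) * exp (- s / \<nu>) \<le> \<nu> powr (- 3 / 4) * exp (- (3 / 4) * (s / \<nu>))"
    by (intro mult_left_mono) auto
  ultimately have "\<nu> powr (- 3 / 4) * exp (- s / \<nu>) \<le> decay s" by linarith
  then have "\<nu> powr (- 5 / 4) * (\<nu> powr (- 3 / 4) * exp (- s / \<nu>)) \<le> \<nu> powr (- 5 / 4) * decay s"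
    by (intro mult_left_mono) auto
  moreover have "\<nu> powr (- 5 / 4) * (\<nu> powr (- 3 / 4) * exp (- s / \<nu>)) = exp (- s / \<nu>) / \<nu>\<^sup>2"
  proof -
    have "\<nu> powr (- 5 / 4) * \<nu> powr (- 3 / 4) = \<nu> powr (- 2)" by (simp flip: powr_add)
    also have "\<dots> = 1 / \<nu>\<^sup>2" using \<nu> by (simp add: powr_minus divide_inverse)
    finally show ?thesis by (metis mult.assoc mult.commute mult.right_neutral times_divide_eq_right)
  qed
  moreover have "\<nu> powr (- 5 / 4) * decay s \<le> real (Suc n) powr (- 5 / 4) * decay s"
    using \<nu> decay_pos[OF assms(2)] by (intro mult_right_mono powr_mono2') auto
  ultimately show ?thesis unfolding \<nu>_def by (simp add: mult.commute)
qed

lemma summable_Suc_powr: "summable (\<lambda>n. real (Suc n) powr (- 5 / 4))"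
  using summable_real_powr_iff[of "- 5 / 4"] summable_Suc_iff[of "\<lambda>n. real n powr (- 5 / 4)"] by simp

text \<open>The kernel that represents both formulas: \<open>j\<close> times the integral of \<open>planck_sum l s * \<psi> s\<close> is the common
  value of the transfer operator, of the Bessel integral and of the Laguerre series.\<close>
definition planck_sum :: "real \<Rightarrow> real \<Rightarrow> real" where
  "planck_sum l s = (\<Sum>n. exp (- s / (real n + l)) / (real n + l)\<^sup>2)"

lemma planck_sum_sums:
  assumes "l \<ge> 1" "s \<ge> 0"
  shows "(\<lambda>n. exp (- s / (real n + l)) / (real n + l)\<^sup>2) sums planck_sum l s"
  unfolding planck_sum_def
proof (rule summable_sums, rule summable_comparison_test')
  show "summable (\<lambda>n. decay s * real (Suc n) powr (- 5 / 4))" by (intro summable_mult summable_Suc_powr)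
  show "norm (exp (- s / (real n + l)) / (real n + l)\<^sup>2) \<le> decay s * real (Suc n) powr (- 5 / 4)" if "n \<ge> 0" for n
    using planck_term_le_decay[OF assms, of n] by simp
qed

lemma planck_sum_nonneg: "l \<ge> 1 \<Longrightarrow> s \<ge> 0 \<Longrightarrow> planck_sum l s \<ge> 0"
  by (rule sums_le[OF _ sums_zero planck_sum_sums]) auto

lemma planck_sum_le_decay:
  assumes "l \<ge> 1" "s \<ge> 0"
  shows "planck_sum l s \<le> decay s * (\<Sum>n. real (Suc n) powr (- 5 / 4))"
proof -
  show ?thesis
    by (rule sums_le[OF planck_term_le_decay[OF assms] planck_sum_sums[OF assms]])
       (intro sums_mult summable_sums summable_Suc_powr)
qed

lemma borel_measurable_planck_sum [measurable]: "planck_sum l \<in> borel_measurable borel"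
  unfolding planck_sum_def[abs_def] by measurable

text \<open>Row sums and column sums of a nonnegative double series: with \<open>\<nu> = n + l\<close>, the exponential series in
  \<open>k\<close> gives \<open>exp (- s) exp (s (1 - 1 / \<nu>)) = exp (- s / \<nu>)\<close>.\<close>
lemma eta_planck_sums:
  assumes l: "l > 1" and s: "s \<ge> 0"
    and E: "\<And>k. (\<lambda>n. (real k + 1) * (1 - 1 / (real n + l)) ^ k / (real n + l)\<^sup>2) sums E k"
  shows "(\<lambda>k. eta k s * E k) sums planck_sum l s"
proof -
  let ?a = "\<lambda>n k. eta k s * ((real k + 1) * (1 - 1 / (real n + l)) ^ k / (real n + l)\<^sup>2)"
  let ?r = "\<lambda>n. exp (- s / (real n + l)) / (real n + l)\<^sup>2"
  have nonneg: "?a n k \<ge> 0" for n k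
    using l s by (auto simp: eta_def intro!: mult_nonneg_nonneg divide_nonneg_nonneg zero_le_power)
  have cols: "(\<lambda>n. ?a n k) sums (eta k s * E k)" for k by (intro sums_mult E)
  have rows: "(\<lambda>k. ?a n k) sums ?r n" for n
  proof -
    define \<nu> where "\<nu> = real n + l"
    have \<nu>: "\<nu> > 0" using l by (simp add: \<nu>_def)
    have "(\<lambda>k. exp (- s) / \<nu>\<^sup>2 * ((s * (1 - 1 / \<nu>)) ^ k /\<^sub>R fact k)) sums (exp (- s) / \<nu>\<^sup>2 * exp (s * (1 - 1 / \<nu>)))"
      by (intro sums_mult exp_converges)
    moreover have "exp (- s) / \<nu>\<^sup>2 * exp (s * (1 - 1 / \<nu>)) = exp (- s / \<nu>) / \<nu>\<^sup>2"
      by (simp add: algebra_simps flip: exp_add)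
    moreover have "exp (- s) / \<nu>\<^sup>2 * ((s * (1 - 1 / \<nu>)) ^ k /\<^sub>R fact k) = eta k s * ((real k + 1) * (1 - 1 / \<nu>) ^ k / \<nu>\<^sup>2)" for k
    proof -
      define c D where "c = real k + 1" and "D = 1 - 1 / \<nu>"
      have "c > 0" "fact (k + 1) = c * fact k" by (auto simp: c_def)
      then show ?thesis
        unfolding eta_def c_def[symmetric] D_def[symmetric] by (simp add: power_mult_distrib field_simps)
    qed
    ultimately show ?thesis unfolding \<nu>_def[symmetric] by (simp only:)
  qed
  show ?thesis
    by (rule sums_swap_nonneg[of ?a ?r, OF nonneg rows cols planck_sum_sums]) (use l s in auto)
qed

text \<open>In both series the terms are nonnegative functions of \<open>s\<close> times \<open>\<psi> s\<close>, with partial sums increasing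
  to \<open>planck_sum l s\<close>, so dominated convergence applies with the same majorant \<open>planck_sum l s * \<bar>\<psi> s\<bar>\<close>.\<close>
lemma
  fixes \<mu> :: "real measure" and \<psi> :: "real \<Rightarrow> real"
  assumes id: "(\<lambda>s. s) \<in> borel_measurable \<mu>"
    and nonneg: "AE s in \<mu>. s \<ge> 0"
    and meas: "\<psi> \<in> borel_measurable \<mu>"
    and decay_int: "integrable \<mu> (\<lambda>s. decay s * \<psi> s)"
    and l: "l > 1"
  shows sums_planck_terms:
    "(\<lambda>n. LINT s|\<mu>. exp (- s / (real n + l)) / (real n + l)\<^sup>2 * \<psi> s) sums (LINT s|\<mu>. planck_sum l s * \<psi> s)"
  and sums_laguerre_terms:
    "(\<And>k. (\<lambda>n. (real k + 1) * (1 - 1 / (real n + l)) ^ k / (real n + l)\<^sup>2) sums E k) \<Longrightarrow>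
     (\<And>k. integrable \<mu> (\<lambda>s. \<psi> s * eta k s)) \<Longrightarrow>
     (\<lambda>k. (LINT s|\<mu>. \<psi> s * eta k s) * E k) sums (LINT s|\<mu>. planck_sum l s * \<psi> s)"
proof -
  let ?h = "\<lambda>n s. exp (- s / (real n + l)) / (real n + l)\<^sup>2"
  have hm: "(\<lambda>s. g s * \<psi> s) \<in> borel_measurable \<mu>" if "g \<in> borel_measurable borel" for g
    using measurable_compose[OF id that] meas by (rule borel_measurable_times)
  have bound_int: "integrable \<mu> (\<lambda>s. g s * \<psi> s)"
    if "g \<in> borel_measurable borel" "\<And>s. s \<ge> 0 \<Longrightarrow> \<bar>g s\<bar> \<le> C * decay s" for g C
  proof (rule Bochner_Integration.integrable_bound[OF integrable_mult_right[OF decay_int, of C] hm[OF that(1)]])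
    show "AE s in \<mu>. norm (g s * \<psi> s) \<le> norm (C * (decay s * \<psi> s))"
      using nonneg
    proof eventually_elim
      case (elim s)
      have "\<bar>g s\<bar> * \<bar>\<psi> s\<bar> \<le> \<bar>C * decay s\<bar> * \<bar>\<psi> s\<bar>"
        using that(2)[OF elim] by (intro mult_right_mono) auto
      then show ?case by (simp add: abs_mult mult_ac)
    qed
  qed
  have l1: "l \<ge> 1" using l by simp
  have h_le: "\<bar>?h n s\<bar> \<le> real (Suc n) powr (- 5 / 4) * decay s" if "s \<ge> 0" for n s
    using planck_term_le_decay[OF l1 that, of n] by (simp add: mult.commute)
  have h_int: "integrable \<mu> (\<lambda>s. ?h n s * \<psi> s)" for n
    by (rule bound_int[OF _ h_le]) measurable
  have H_int: "integrable \<mu> (\<lambda>s. planck_sum l s * \<psi> s)"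
    by (rule bound_int[where C = "\<Sum>n. real (Suc n) powr (- 5 / 4)"])
       (use planck_sum_le_decay[OF l1] planck_sum_nonneg[OF l1] in \<open>auto simp: mult.commute\<close>)
  have limit: "(\<lambda>n. LINT s|\<mu>. f n s) sums (LINT s|\<mu>. planck_sum l s * \<psi> s)"
    if f_int: "\<And>n. integrable \<mu> (f n)"
      and f_eq: "\<And>n s. s \<ge> 0 \<Longrightarrow> f n s = g n s * \<psi> s"
      and g_nonneg: "\<And>n s. s \<ge> 0 \<Longrightarrow> g n s \<ge> 0"
      and g_sums: "\<And>s. s \<ge> 0 \<Longrightarrow> (\<lambda>n. g n s) sums planck_sum l s" for f g :: "nat \<Rightarrow> real \<Rightarrow> real"
  proof -
    have "(\<lambda>N. LINT s|\<mu>. (\<Sum>n<N. f n s)) \<longlonglongrightarrow> (LINT s|\<mu>. planck_sum l s * \<psi> s)"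
    proof (rule integral_dominated_convergence[where w = "\<lambda>s. norm (planck_sum l s * \<psi> s)"])
      show "AE s in \<mu>. (\<lambda>N. \<Sum>n<N. f n s) \<longlonglongrightarrow> planck_sum l s * \<psi> s"
        using nonneg
      proof eventually_elim
        case (elim s)
        have "(\<lambda>n. g n s * \<psi> s) sums (planck_sum l s * \<psi> s)" by (intro sums_mult2 g_sums elim)
        then show ?case using f_eq[OF elim] by (simp add: sums_def)
      qed
      show "AE s in \<mu>. norm (\<Sum>n<N. f n s) \<le> norm (planck_sum l s * \<psi> s)" for N
        using nonneg
      proof eventually_elim
        case (elim s)
        have "(\<Sum>n<N. f n s) = (\<Sum>n<N. g n s) * \<psi> s" using f_eq[OF elim] by (simp add: sum_distrib_right)
        moreover have "0 \<le> (\<Sum>n<N. g n s)" using g_nonneg[OF elim] by (intro sum_nonneg) auto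
        moreover have "(\<Sum>n<N. g n s) \<le> planck_sum l s"
          using sum_le_suminf[of "\<lambda>n. g n s" "{..<N}"] g_sums[OF elim] g_nonneg[OF elim] by (auto simp: sums_iff)
        ultimately show ?case by (simp add: abs_mult mult_right_mono)
      qed
      show "integrable \<mu> (\<lambda>s. norm (planck_sum l s * \<psi> s))" using H_int by (rule integrable_norm)
    qed (use f_int H_int in \<open>auto intro!: borel_measurable_integrable borel_measurable_sum\<close>)
    moreover have "(LINT s|\<mu>. (\<Sum>n<N. f n s)) = (\<Sum>n<N. LINT s|\<mu>. f n s)" for N
      by (rule Bochner_Integration.integral_sum) (rule f_int)
    ultimately show ?thesis by (simp add: sums_def)
  qed
  show "(\<lambda>n. LINT s|\<mu>. ?h n s * \<psi> s) sums (LINT s|\<mu>. planck_sum l s * \<psi> s)"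
    by (rule limit[where g = ?h, OF h_int]) (use planck_sum_sums[OF l1] in auto)
  show "(\<lambda>k. (LINT s|\<mu>. \<psi> s * eta k s) * E k) sums (LINT s|\<mu>. planck_sum l s * \<psi> s)"
    if E: "\<And>k. (\<lambda>n. (real k + 1) * (1 - 1 / (real n + l)) ^ k / (real n + l)\<^sup>2) sums E k"
      and int: "\<And>k. integrable \<mu> (\<lambda>s. \<psi> s * eta k s)"
  proof -
    have "E k \<ge> 0" for k
      by (rule sums_le[OF _ sums_zero E[of k]])
         (use l in \<open>auto intro!: divide_nonneg_nonneg mult_nonneg_nonneg zero_le_power\<close>)
    then have "(\<lambda>k. LINT s|\<mu>. \<psi> s * eta k s * E k) sums (LINT s|\<mu>. planck_sum l s * \<psi> s)"
      by (intro limit[where g = "\<lambda>k s. eta k s * E k"] integrable_mult_left int eta_planck_sums l E)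
         (auto simp: eta_def)
    then show ?thesis by simp
  qed
qed

section \<open>Branches of the triangle partition maps\<close>

text \<open>Homogeneous coordinates \<open>B\<^sup>-\<^sup>1(1, x, y)\<close>, in which the triangle is the positive cone and the branches
  are given by nonnegative matrices.\<close>
definition bary :: "real \<times> real \<Rightarrow> real^3" where
  "bary = (\<lambda>(x, y). vector [1 - x, x - y, y])"

lemma bary_nth: "bary p $ 1 = 1 - fst p" "bary p $ 2 = fst p - snd p" "bary p $ 3 = snd p"
  by (simp_all add: bary_def split_beta)

definition positive_cone :: "(real^3) set" where
  "positive_cone = {v. 0 < v $ 1 \<and> 0 < v $ 2 \<and> 0 < v $ 3}"

lemma bary_in_positive_cone_iff: "bary p \<in> positive_cone \<longleftrightarrow> p \<in> open_triangle"
  by (auto simp: positive_cone_def bary_nth open_triangle_def)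

lemma perm_nth:
  "(perm_matrix S_e *v v) $ 1 = v $ 1" "(perm_matrix S_e *v v) $ 2 = v $ 2" "(perm_matrix S_e *v v) $ 3 = v $ 3"
  "(perm_matrix S_12 *v v) $ 1 = v $ 2" "(perm_matrix S_12 *v v) $ 2 = v $ 1" "(perm_matrix S_12 *v v) $ 3 = v $ 3"
  "(perm_matrix S_13 *v v) $ 1 = v $ 3" "(perm_matrix S_13 *v v) $ 2 = v $ 2" "(perm_matrix S_13 *v v) $ 3 = v $ 1"
  "(perm_matrix S_23 *v v) $ 1 = v $ 1" "(perm_matrix S_23 *v v) $ 2 = v $ 3" "(perm_matrix S_23 *v v) $ 3 = v $ 2"
  "(perm_matrix S_123 *v v) $ 1 = v $ 2" "(perm_matrix S_123 *v v) $ 2 = v $ 3" "(perm_matrix S_123 *v v) $ 3 = v $ 1"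
  "(perm_matrix S_132 *v v) $ 1 = v $ 3" "(perm_matrix S_132 *v v) $ 2 = v $ 1" "(perm_matrix S_132 *v v) $ 3 = v $ 2"
  by (simp_all add: matrix_vector_mult_def matrix_def sum_3 axis_def)

declare perm_matrix.simps [simp del] matF0.simps [simp del] matF1.simps [simp del]

lemma A0_nth: "(matA0 *v v) $ 1 = v $ 3" "(matA0 *v v) $ 2 = v $ 1" "(matA0 *v v) $ 3 = v $ 2 + v $ 3"
  by (simp_all add: matA0_def matrix_vector_mult_def sum_3)

lemma A1_nth: "(matA1 *v v) $ 1 = v $ 1 + v $ 3" "(matA1 *v v) $ 2 = v $ 2" "(matA1 *v v) $ 3 = v $ 3"
  by (simp_all add: matA1_def matrix_vector_mult_def sum_3)

lemma B_nth: "(matB *v v) $ 1 = v $ 1 + v $ 2 + v $ 3" "(matB *v v) $ 2 = v $ 2 + v $ 3" "(matB *v v) $ 3 = v $ 3"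
  by (simp_all add: matB_def matrix_vector_mult_def sum_3)

lemma perm_positive: "v \<in> positive_cone \<Longrightarrow> perm_matrix \<sigma> *v v \<in> positive_cone"
  by (cases \<sigma>) (auto simp: positive_cone_def perm_nth)

lemma perm_inj: "perm_matrix \<sigma> *v v = perm_matrix \<sigma> *v w \<Longrightarrow> v = w"
  by (cases \<sigma>) (auto simp: vec_eq_iff forall_3 perm_nth)

lemma perm_sum: "(\<Sum>i\<in>UNIV. (perm_matrix \<sigma> *v v) $ i) = (\<Sum>i\<in>UNIV. v $ i)"
  by (cases \<sigma>) (auto simp: perm_nth sum_3)

lemma F0_mult: "matF0 (\<sigma>, \<tau>0, \<tau>1) *v v = perm_matrix \<sigma> *v (matA0 *v (perm_matrix \<tau>0 *v v))"
  by (simp add: matF0.simps matF1.simps matrix_vector_mul_assoc matrix_mul_assoc)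

lemma F1_mult: "matF1 (\<sigma>, \<tau>0, \<tau>1) *v v = perm_matrix \<sigma> *v (matA1 *v (perm_matrix \<tau>1 *v v))"
  by (simp add: matF0.simps matF1.simps matrix_vector_mul_assoc matrix_mul_assoc)

lemma A0_positive: "v \<in> positive_cone \<Longrightarrow> matA0 *v v \<in> positive_cone"
  by (auto simp: positive_cone_def A0_nth)

lemma A1_positive: "v \<in> positive_cone \<Longrightarrow> matA1 *v v \<in> positive_cone"
  by (auto simp: positive_cone_def A1_nth)

lemma F0_positive: "v \<in> positive_cone \<Longrightarrow> matF0 X *v v \<in> positive_cone"
  by (cases X) (simp add: F0_mult perm_positive A0_positive)

lemma F1_positive: "v \<in> positive_cone \<Longrightarrow> matF1 X *v v \<in> positive_cone"
  by (cases X) (simp add: F1_mult perm_positive A1_positive)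

lemma F0_inj: "matF0 X *v v = matF0 X *v w \<Longrightarrow> v = w"
proof (cases X)
  case (fields \<sigma> \<tau>0 \<tau>1)
  assume "matF0 X *v v = matF0 X *v w"
  then have "matA0 *v (perm_matrix \<tau>0 *v v) = matA0 *v (perm_matrix \<tau>0 *v w)"
    unfolding fields F0_mult by (rule perm_inj)
  then have "perm_matrix \<tau>0 *v v = perm_matrix \<tau>0 *v w" by (simp add: vec_eq_iff forall_3 A0_nth)
  then show ?thesis by (rule perm_inj)
qed

lemma F1_inj: "matF1 X *v v = matF1 X *v w \<Longrightarrow> v = w"
proof (cases X)
  case (fields \<sigma> \<tau>0 \<tau>1)
  assume "matF1 X *v v = matF1 X *v w"
  then have "matA1 *v (perm_matrix \<tau>1 *v v) = matA1 *v (perm_matrix \<tau>1 *v w)"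
    unfolding fields F1_mult by (rule perm_inj)
  then have "perm_matrix \<tau>1 *v v = perm_matrix \<tau>1 *v w" by (simp add: vec_eq_iff forall_3 A1_nth)
  then show ?thesis by (rule perm_inj)
qed

text \<open>Before the common permutation \<open>\<sigma>\<close> is applied, the third coordinate exceeds the first one in the image
  of \<open>A\<^sub>0\<close>, and the first exceeds the third in the image of \<open>A\<^sub>1\<close>.\<close>
lemma F0_F1_images_disjoint:
  assumes "v \<in> positive_cone" "w \<in> positive_cone" shows "matF0 X *v v \<noteq> matF1 X *v w"
proof (cases X)
  case (fields \<sigma> \<tau>0 \<tau>1)
  let ?v = "perm_matrix \<tau>0 *v v" and ?w = "perm_matrix \<tau>1 *v w"
  have "?v \<in> positive_cone" "?w \<in> positive_cone" using assms by (simp_all add: perm_positive)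
  then have "matA0 *v ?v \<noteq> matA1 *v ?w"
    by (auto simp: vec_eq_iff forall_3 A0_nth A1_nth positive_cone_def)
  then show ?thesis unfolding fields F0_mult F1_mult using perm_inj by blast
qed

definition cone_branch :: "triple \<Rightarrow> nat \<Rightarrow> real \<times> real \<Rightarrow> real^3" where
  "cone_branch X k p = (((**) (matF1 X)) ^^ k) (matF0 X) *v bary p"

lemma cone_branch_0: "cone_branch X 0 p = matF0 X *v bary p"
  by (simp add: cone_branch_def)

lemma cone_branch_Suc: "cone_branch X (Suc k) p = matF1 X *v cone_branch X k p"
  by (simp add: cone_branch_def matrix_vector_mul_assoc)

lemma cone_branch_positive: "p \<in> open_triangle \<Longrightarrow> cone_branch X k p \<in> positive_cone"
  by (induction k) (simp_all add: cone_branch_0 cone_branch_Suc F0_positive F1_positive bary_in_positive_cone_iff)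

definition matB_inv :: "real^3^3" where
  "matB_inv = vector [vector [1, -1, 0], vector [0, 1, -1], vector [0, 0, 1]]"

lemma matB_inverse: "matB ** matB_inv = mat 1" "matB_inv ** matB = mat 1"
  by (simp_all add: matB_def matB_inv_def matrix_matrix_mult_def mat_def vec_eq_iff forall_3 sum_3)

lemma matrix_inv_eqI:
  fixes A :: "real^'n^'n"
  assumes "A ** A' = mat 1" "A' ** A = mat 1"
  shows "matrix_inv A = A'"
proof -
  have inv: "A ** matrix_inv A = mat 1 \<and> matrix_inv A ** A = mat 1"
    unfolding matrix_inv_def by (rule someI[of _ A']) (use assms in simp)
  have "matrix_inv A = matrix_inv A ** (A ** A')" using assms by simp
  also have "\<dots> = A'" using inv by (simp add: matrix_mul_assoc)
  finally show ?thesis .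
qed

lemma matrix_inv_matB: "matrix_inv matB = matB_inv"
  by (rule matrix_inv_eqI) (rule matB_inverse)+

lemma matB_inv_mult: "matB_inv *v vector [1, x, y] = bary (x, y)"
  by (simp add: matB_inv_def bary_def matrix_vector_mult_def vec_eq_iff forall_3 sum_3)

lemma dpq_eq: "dpq X k p = matB *v cone_branch X k p"
  by (cases p) (simp add: dpq_def cone_branch_def matrix_inv_matB matB_inv_mult flip: matrix_vector_mul_assoc)

lemma dpq_pos: "p \<in> open_triangle \<Longrightarrow> dpq X k p $ 1 > 0"
  using cone_branch_positive[of p X k] by (auto simp: dpq_eq B_nth positive_cone_def)

lemma bary_Sk: 
  assumes "p \<in> open_triangle"
  shows "dpq X k p $ 1 *\<^sub>R bary (Sk X k p) = cone_branch X k p"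
proof -
  have "dpq X k p $ 1 \<noteq> 0" using dpq_pos[OF assms, of X k] by simp
  moreover have "cone_branch X k p $ 1 = dpq X k p $ 1 - dpq X k p $ 2"
    "cone_branch X k p $ 2 = dpq X k p $ 2 - dpq X k p $ 3" "cone_branch X k p $ 3 = dpq X k p $ 3"
    by (simp_all add: dpq_eq B_nth)
  ultimately show ?thesis
    by (simp add: vec_eq_iff forall_3 bary_nth Sk_def right_diff_distrib)
qed

lemma Sk_in_open_triangle:
  assumes "p \<in> open_triangle" shows "Sk X k p \<in> open_triangle"
proof -
  have "dpq X k p $ 1 *\<^sub>R bary (Sk X k p) \<in> positive_cone"
    unfolding bary_Sk[OF assms] by (rule cone_branch_positive[OF assms])
  then have "bary (Sk X k p) \<in> positive_cone"
    using dpq_pos[OF assms, of X k] by (simp add: positive_cone_def zero_less_mult_iff)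
  then show ?thesis by (simp add: bary_in_positive_cone_iff)
qed

text \<open>Equality of two branch points means proportionality of the cone vectors. Cancelling the injective
  \<open>F\<^sub>1\<close> on both sides leaves either two points of the image of \<open>F\<^sub>0\<close> or a point of the image of \<open>F\<^sub>0\<close> and one of the image
  of \<open>F\<^sub>1\<close>, and the latter is impossible.\<close>
lemma cone_branch_proportional:
  assumes "p \<in> open_triangle" "q \<in> open_triangle" "c > 0" "k \<le> m"
    and "cone_branch X k p = c *\<^sub>R cone_branch X m q"
  shows "k = m \<and> p = q"
  using assms(4,5)
proof (induction k arbitrary: m)
  case 0
  show ?case
  proof (cases m)
    case 0
    with \<open>cone_branch X 0 p = c *\<^sub>R cone_branch X m q\<close> have "matF0 X *v bary p = matF0 X *v (c *\<^sub>R bary q)"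
      by (simp add: cone_branch_0 matrix_vector_mult_scaleR)
    then have "bary p = c *\<^sub>R bary q" by (rule F0_inj)
    then have b: "1 - fst p = c * (1 - fst q)" "fst p - snd p = c * (fst q - snd q)" "snd p = c * snd q"
      by (simp_all add: vec_eq_iff forall_3 bary_nth)
    then have "c = 1" by (simp add: algebra_simps)
    with b 0 show ?thesis by (simp add: prod_eq_iff)
  next
    case (Suc m')
    have "matF0 X *v bary p = matF1 X *v (c *\<^sub>R cone_branch X m' q)"
      using 0 Suc by (simp add: cone_branch_0 cone_branch_Suc matrix_vector_mult_scaleR)
    moreover have "c *\<^sub>R cone_branch X m' q \<in> positive_cone"
      using cone_branch_positive[OF assms(2), of X m'] assms(3) by (simp add: positive_cone_def)
    ultimately show ?thesis
      using F0_F1_images_disjoint[of "bary p"] assms(1) by (simp add: bary_in_positive_cone_iff)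
  qed
next
  case (Suc k)
  then obtain m' where m: "m = Suc m'" "k \<le> m'" by (cases m) auto
  have "matF1 X *v cone_branch X k p = matF1 X *v (c *\<^sub>R cone_branch X m' q)"
    using Suc.prems m by (simp add: cone_branch_Suc matrix_vector_mult_scaleR)
  then have "cone_branch X k p = c *\<^sub>R cone_branch X m' q" by (rule F1_inj)
  with Suc.IH[OF m(2)] m show ?case by simp
qed

lemma Sk_inj:
  assumes p: "p \<in> open_triangle" and q: "q \<in> open_triangle" and eq: "Sk X k p = Sk X m q"
  shows "k = m \<and> p = q"
proof -
  have main: "k = m \<and> p = q"
    if "p \<in> open_triangle" "q \<in> open_triangle" "Sk X k p = Sk X m q" "k \<le> m" for p q k m
  proof (rule cone_branch_proportional[OF that(1,2) _ that(4)])
    show "dpq X k p $ 1 / dpq X m q $ 1 > 0" using dpq_pos that by simp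
    show "cone_branch X k p = (dpq X k p $ 1 / dpq X m q $ 1) *\<^sub>R cone_branch X m q"
      using dpq_pos[OF that(2), of X m]
      by (simp add: that(3) flip: bary_Sk[OF that(1)] bary_Sk[OF that(2)])
  qed
  show ?thesis
  proof (cases "k \<le> m")
    case True
    then show ?thesis using main[OF p q eq] by simp
  next
    case False
    then show ?thesis using main[OF q p eq[symmetric]] by simp
  qed
qed

lemma tp_map_Sk:
  assumes "p \<in> open_triangle" shows "tp_map X (Sk X k p) = p"
proof -
  have "(THE m. Sk X k p \<in> Sk X m ` open_triangle) = k"
    using assms by (intro the_equality) (auto dest: Sk_inj[rotated 2])
  moreover have "inj_on (Sk X k) open_triangle"
    by (rule inj_onI) (use Sk_inj in blast)
  ultimately show ?thesis using assms by (simp add: tp_map_def)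
qed

lemma bij_betw_preimages:
  assumes "p \<in> open_triangle" shows "bij_betw (\<lambda>k. Sk X k p) UNIV (preimages X p)"
  unfolding bij_betw_def
proof
  show "inj (\<lambda>k. Sk X k p)"
    by (rule injI) (use Sk_inj[OF assms assms] in blast)
  show "range (\<lambda>k. Sk X k p) = preimages X p"
    using assms by (auto simp: preimages_def tp_domain_def tp_map_Sk)
qed

definition proj_map :: "real^3^3 \<Rightarrow> real \<times> real \<Rightarrow> real \<times> real" where
  "proj_map M p = (let w = M *v vector [1, fst p, snd p] in (w $ 2 / w $ 1, w $ 3 / w $ 1))"

lemma affine_nth: "(M *v vector [1, x, y]) $ i = M $ i $ 1 + M $ i $ 2 * x + M $ i $ 3 * y" for M :: "real^3^3"
  by (simp add: matrix_vector_mult_def sum_3)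

lemma proj_map_lift:
  assumes "(M *v vector [1, fst p, snd p]) $ 1 \<noteq> 0"
  shows "M *v vector [1, fst p, snd p]
    = (M *v vector [1, fst p, snd p]) $ 1 *\<^sub>R vector [1, fst (proj_map M p), snd (proj_map M p)]"
  using assms by (simp add: vec_eq_iff forall_3 proj_map_def Let_def)

lemma proj_map_inverse:
  assumes "N ** M = mat 1" and "(M *v vector [1, fst p, snd p]) $ 1 \<noteq> 0"
  shows "N *v vector [1, fst (proj_map M p), snd (proj_map M p)]
      = (1 / (M *v vector [1, fst p, snd p]) $ 1) *\<^sub>R vector [1, fst p, snd p]"
    and "proj_map N (proj_map M p) = p"
proof -
  let ?c = "(M *v vector [1, fst p, snd p]) $ 1"
  have "?c *\<^sub>R (N *v vector [1, fst (proj_map M p), snd (proj_map M p)]) = N *v (M *v vector [1, fst p, snd p])"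
    by (subst (2) proj_map_lift[OF assms(2)]) (simp add: matrix_vector_mult_scaleR)
  also have "\<dots> = vector [1, fst p, snd p]" using assms(1) by (simp add: matrix_vector_mul_assoc)
  finally show *: "N *v vector [1, fst (proj_map M p), snd (proj_map M p)] = (1 / ?c) *\<^sub>R vector [1, fst p, snd p]"
    using assms(2) by (simp add: vec_eq_iff field_simps)
  show "proj_map N (proj_map M p) = p"
    using assms(2) by (subst proj_map_def) (simp add: * Let_def)
qed

lemma jac_det_proj_map:
  assumes n1: "(N *v vector [1, a, b]) $ 1 \<noteq> 0"
  shows "jac_det (proj_map N) (a, b) = det N / ((N *v vector [1, a, b]) $ 1) ^ 3"
proof -
  define n where "n i = N $ i $ 1 + N $ i $ 2 * a + N $ i $ 3 * b" for i
  have n: "n 1 \<noteq> 0" using n1 by (simp add: affine_nth n_def)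
  have da: "deriv (\<lambda>u. (N $ i $ 1 + N $ i $ 2 * u + N $ i $ 3 * b) / (N $ 1 $ 1 + N $ 1 $ 2 * u + N $ 1 $ 3 * b)) a
      = (N $ i $ 2 * n 1 - n i * N $ 1 $ 2) / (n 1)\<^sup>2" for i
    by (rule DERIV_imp_deriv)
       (use n in \<open>auto intro!: derivative_eq_intros simp: n_def power2_eq_square\<close>)
  have db: "deriv (\<lambda>v. (N $ i $ 1 + N $ i $ 2 * a + N $ i $ 3 * v) / (N $ 1 $ 1 + N $ 1 $ 2 * a + N $ 1 $ 3 * v)) b
      = (N $ i $ 3 * n 1 - n i * N $ 1 $ 3) / (n 1)\<^sup>2" for i
    by (rule DERIV_imp_deriv)
       (use n in \<open>auto intro!: derivative_eq_intros simp: n_def power2_eq_square\<close>)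
  have "jac_det (proj_map N) (a, b)
     = (N $ 2 $ 2 * n 1 - n 2 * N $ 1 $ 2) / (n 1)\<^sup>2 * ((N $ 3 $ 3 * n 1 - n 3 * N $ 1 $ 3) / (n 1)\<^sup>2)
     - (N $ 2 $ 3 * n 1 - n 2 * N $ 1 $ 3) / (n 1)\<^sup>2 * ((N $ 3 $ 2 * n 1 - n 3 * N $ 1 $ 2) / (n 1)\<^sup>2)"
    by (simp add: jac_det_def proj_map_def Let_def affine_nth da db)
  also have "\<dots> = (n 1 * det N) / (n 1) ^ 4"
  proof -
    have "(N $ 2 $ 2 * n 1 - n 2 * N $ 1 $ 2) * (N $ 3 $ 3 * n 1 - n 3 * N $ 1 $ 3)
       - (N $ 2 $ 3 * n 1 - n 2 * N $ 1 $ 3) * (N $ 3 $ 2 * n 1 - n 3 * N $ 1 $ 2) = n 1 * det N"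
      unfolding det_3 n_def by algebra
    then show ?thesis by (simp add: diff_divide_distrib[symmetric] power4_eq_xxxx power2_eq_square mult.assoc)
  qed
  also have "\<dots> = det N / (n 1) ^ 3" using n by (simp add: power4_eq_xxxx power3_eq_cube)
  finally show ?thesis by (simp add: affine_nth n_def)
qed

lemma abs_det_perm: "\<bar>det (perm_matrix \<sigma>)\<bar> = 1"
  by (cases \<sigma>) (simp_all add: perm_matrix.simps det_3 matrix_def axis_def)

definition branch_matrix :: "triple \<Rightarrow> nat \<Rightarrow> real^3^3" where
  "branch_matrix X k = matB ** (((**) (matF1 X)) ^^ k) (matF0 X) ** matrix_inv matB"

lemma abs_det_branch_matrix: "\<bar>det (branch_matrix X k)\<bar> = 1"
proof -
  obtain \<sigma> \<tau>0 \<tau>1 where X: "X = (\<sigma>, \<tau>0, \<tau>1)" by (cases X)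
  have "det matA0 = 1" "det matA1 = 1" "det matB = 1" "det matB_inv = 1"
    by (simp_all add: det_3 matA0_def matA1_def matB_def matB_inv_def)
  moreover have "\<bar>det ((((**) (matF1 X)) ^^ k) (matF0 X))\<bar> = 1"
    by (induction k) (simp_all add: X matF0.simps matF1.simps det_mul abs_mult abs_det_perm calculation)
  ultimately show ?thesis by (simp add: branch_matrix_def matrix_inv_matB det_mul abs_mult)
qed

lemma dpq_eq_branch_matrix: "dpq X k p = branch_matrix X k *v vector [1, fst p, snd p]"
  by (cases p) (simp add: dpq_def branch_matrix_def)

lemma Sk_eq_proj_map: "Sk X k = proj_map (branch_matrix X k)"
  by (simp add: fun_eq_iff Sk_def proj_map_def dpq_eq_branch_matrix Let_def)

lemma open_open_triangle: "open open_triangle"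
proof -
  have "open_triangle = {p. 0 < snd p} \<inter> {p. snd p < fst p} \<inter> {p. fst p < 1}"
    by (auto simp: open_triangle_def)
  also have "open \<dots>"
    by (intro open_Int open_Collect_less continuous_intros)
  finally show ?thesis .
qed

text \<open>Near a branch point the map is the projective map of the inverse matrix \<open>N\<close>, whose determinant is
  \<open>1\<close> up to sign and whose denominator there is the reciprocal of \<open>d\<^sub>k\<close>.\<close>
lemma abs_jac_det_tp_map:
  assumes p: "p \<in> open_triangle"
  shows "\<bar>jac_det (tp_map X) (Sk X k p)\<bar> = (dpq X k p $ 1) ^ 3"
proof -
  define M where "M = branch_matrix X k"
  define q where "q = Sk X k p"
  have dM: "\<bar>det M\<bar> = 1" by (simp add: M_def abs_det_branch_matrix)
  then have "invertible M" by (auto simp: invertible_det_nz)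
  then obtain N where inv: "M ** N = mat 1" "N ** M = mat 1" by (auto simp: invertible_def)
  define L where "L q = (N *v vector [1, fst q, snd q]) $ 1" for q :: "real \<times> real"
  have "det N * det M = 1" by (metis det_I det_mul inv(2))
  with dM have dN: "\<bar>det N\<bar> = 1" by (metis abs_mult abs_one mult.right_neutral)
  have d: "dpq X k p $ 1 = (M *v vector [1, fst p, snd p]) $ 1" by (simp add: dpq_eq_branch_matrix M_def)
  have q: "q = proj_map M p" by (simp add: q_def M_def Sk_eq_proj_map)
  have d0: "(M *v vector [1, fst p, snd p]) $ 1 \<noteq> 0" using dpq_pos[OF p, of X k] by (simp add: d)
  have Lq: "L q = 1 / dpq X k p $ 1"
    unfolding L_def q proj_map_inverse(1)[OF inv(2) d0] by (simp add: d)
  have pq: "proj_map N q = p" unfolding q by (rule proj_map_inverse(2)[OF inv(2) d0])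
  have Lq0: "L q > 0" using Lq dpq_pos[OF p, of X k] by simp
  have L_cont: "isCont L q"
    unfolding L_def[abs_def] affine_nth by (intro continuous_intros)
  have "N $ 1 $ 1 + N $ 1 $ 2 * fst q + N $ 1 $ 3 * snd q \<noteq> 0"
    using Lq0 by (simp add: L_def affine_nth)
  then have "isCont (proj_map N) q"
    unfolding proj_map_def[abs_def] Let_def affine_nth by (intro continuous_intros)
  then have "(proj_map N \<longlongrightarrow> proj_map N q) (nhds q)"
    unfolding isCont_def tendsto_at_iff_tendsto_nhds .
  then have "(proj_map N \<longlongrightarrow> p) (nhds q)" unfolding pq .
  then have "\<forall>\<^sub>F q' in nhds q. proj_map N q' \<in> open_triangle"
    by (rule topological_tendstoD[OF _ open_open_triangle p])
  moreover have "(L \<longlongrightarrow> L q) (nhds q)"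
    using L_cont unfolding isCont_def tendsto_at_iff_tendsto_nhds .
  then have "\<forall>\<^sub>F q' in nhds q. 0 < L q'"
    using Lq0 by (rule order_tendstoD)
  ultimately have ev: "\<forall>\<^sub>F q' in nhds q. tp_map X q' = proj_map N q'"
  proof eventually_elim
    case (elim q')
    have "Sk X k (proj_map N q') = q'"
      unfolding Sk_eq_proj_map M_def[symmetric] using elim(2)
      by (intro proj_map_inverse(2)[OF inv(1)]) (simp add: L_def)
    then show ?case using tp_map_Sk[OF elim(1), of X k] by simp
  qed
  obtain a b where ab: "q = (a, b)" by (cases q)
  have ev_a: "\<forall>\<^sub>F u in nhds a. tp_map X (u, b) = proj_map N (u, b)"
    using ev unfolding ab by (rule eventually_compose_filterlim) (intro tendsto_intros filterlim_ident)
  have ev_b: "\<forall>\<^sub>F v in nhds b. tp_map X (a, v) = proj_map N (a, v)"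
    using ev unfolding ab by (rule eventually_compose_filterlim) (intro tendsto_intros filterlim_ident)
  have "jac_det (tp_map X) q = jac_det (proj_map N) q"
    unfolding ab jac_det_def prod.case
    by (intro arg_cong2[of _ _ _ _ "(-)"] arg_cong2[of _ _ _ _ "(*)"] deriv_cong_ev refl
        eventually_mono[OF ev_a] eventually_mono[OF ev_b]) simp_all
  also have "\<dots> = det N / (L q) ^ 3"
    using jac_det_proj_map[of N a b] Lq0 by (simp add: ab L_def)
  finally have "\<bar>jac_det (tp_map X) q\<bar> = 1 / (L q) ^ 3" using dN Lq0 by (simp add: abs_divide)
  then show ?thesis by (simp add: q_def[symmetric] Lq power_divide)
qed

lemma transfer_operator_sums:
  assumes p: "p \<in> open_triangle"
    and sm: "(\<lambda>q. f q / \<bar>jac_det (tp_map X) q\<bar>) summable_on preimages X p"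
  shows "(\<lambda>k. f (Sk X k p) / (dpq X k p $ 1) ^ 3) sums transfer_operator X f p"
proof -
  let ?g = "\<lambda>q. f q / \<bar>jac_det (tp_map X) q\<bar>"
  have g: "?g (Sk X k p) = f (Sk X k p) / (dpq X k p $ 1) ^ 3" for k
    by (simp add: abs_jac_det_tp_map[OF p])
  have "(\<lambda>k. ?g (Sk X k p)) summable_on UNIV"
    using sm summable_on_reindex_bij_betw[OF bij_betw_preimages[OF p, of X], of ?g] by blast
  then have "((\<lambda>k. ?g (Sk X k p)) has_sum (\<Sum>\<^sub>\<infinity>k. ?g (Sk X k p))) UNIV"
    by (rule has_sum_infsum)
  moreover have "(\<Sum>\<^sub>\<infinity>k. ?g (Sk X k p)) = transfer_operator X f p"
    unfolding transfer_operator_def by (rule infsum_reindex_bij_betw[OF bij_betw_preimages[OF p]])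
  ultimately show ?thesis unfolding g by (simp add: has_sum_imp_sums)
qed

text \<open>The homogeneous coordinate \<open>h\<close> (for the given \<open>\<sigma>\<close>), which \<open>F\<^sub>1\<close> preserves for the listed triples.\<close>
fun fixed_coord :: "s3 \<Rightarrow> 3" where
  "fixed_coord S_e = 3" | "fixed_coord S_12 = 3" | "fixed_coord S_13 = 1"
| "fixed_coord S_23 = 2" | "fixed_coord S_123 = 2" | "fixed_coord S_132 = 1"

lemma h_fun_eq: "h_fun \<sigma> p = bary p $ fixed_coord \<sigma>"
  by (cases p; cases \<sigma>) (simp_all add: bary_nth)

lemma perm_fixed_coord: "(perm_matrix \<sigma> *v v) $ fixed_coord \<sigma> = v $ 3"
  by (cases \<sigma>) (simp_all add: perm_nth)

text \<open>Common to all listed pairs \<open>(\<sigma>, \<tau>\<^sub>1)\<close>: \<open>\<tau>\<^sub>1\<close> moves the distinguished coordinate to the third place, where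
  \<open>A\<^sub>1\<close> keeps it and adds it to the first one, and from where \<open>\<sigma>\<close> moves it back.\<close>
lemma good_fixed_coord:
  assumes "(\<sigma>, \<tau>0, \<tau>1) \<in> good_triples"
  shows "(perm_matrix \<tau>1 *v v) $ 3 = v $ fixed_coord \<sigma>"
  using assms by (auto simp: good_triples_def perm_nth)

text \<open>\<open>F\<^sub>1\<close> preserves the distinguished coordinate and adds it to the sum of the coordinates, so the
  denominator \<open>d\<^sub>k\<close> grows linearly in \<open>k\<close>.\<close>
lemma good_branch:
  assumes good: "(\<sigma>, \<tau>0, \<tau>1) \<in> good_triples"
  defines "X \<equiv> (\<sigma>, \<tau>0, \<tau>1)" and "v \<equiv> \<lambda>p. perm_matrix \<tau>0 *v bary p"
  shows "cone_branch X k p $ fixed_coord \<sigma> = v p $ 2 + v p $ 3"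
    and "dpq X k p $ 1 = real k * (v p $ 2 + v p $ 3) + (1 + v p $ 3)"
proof -
  have sum: "dpq X k p $ 1 = (\<Sum>i\<in>UNIV. cone_branch X k p $ i)" for k
    by (simp add: dpq_eq B_nth sum_3)
  have v1: "(\<Sum>i\<in>UNIV. v p $ i) = 1" by (simp add: v_def perm_sum) (simp add: sum_3 bary_nth)
  show 1: "cone_branch X k p $ fixed_coord \<sigma> = v p $ 2 + v p $ 3" for k
  proof (induction k)
    case 0
    show ?case by (simp add: cone_branch_0 X_def F0_mult perm_fixed_coord A0_nth v_def)
  next
    case (Suc k)
    then show ?case
      by (simp add: cone_branch_Suc X_def F1_mult perm_fixed_coord A1_nth good_fixed_coord[OF good])
  qed
  have A0: "(\<Sum>i\<in>UNIV. (matA0 *v w) $ i) = (\<Sum>i\<in>UNIV. w $ i) + w $ 3" for w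
    by (simp add: sum_3 A0_nth)
  have A1: "(\<Sum>i\<in>UNIV. (matA1 *v w) $ i) = (\<Sum>i\<in>UNIV. w $ i) + w $ 3" for w
    by (simp add: sum_3 A1_nth)
  show "dpq X k p $ 1 = real k * (v p $ 2 + v p $ 3) + (1 + v p $ 3)"
  proof (induction k)
    case 0
    have "dpq X 0 p $ 1 = (\<Sum>i\<in>UNIV. v p $ i) + v p $ 3"
      unfolding sum cone_branch_0 by (simp add: X_def F0_mult perm_sum A0 v_def)
    then show ?case using v1 by simp
  next
    case (Suc k)
    have "dpq X (Suc k) p $ 1 = dpq X k p $ 1 + cone_branch X k p $ fixed_coord \<sigma>"
      unfolding sum cone_branch_Suc by (simp add: X_def F1_mult perm_sum A1 good_fixed_coord[OF good])
    then show ?case using Suc 1 by (simp add: algebra_simps)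
  qed
qed

lemma l_fun_j_fun_eq:
  assumes "p \<in> open_triangle"
  defines "v \<equiv> \<lambda>\<tau>0. perm_matrix \<tau>0 *v bary p"
  shows "v \<tau>0 $ 2 + v \<tau>0 $ 3 > 0"
    and "l_fun (\<sigma>, \<tau>0, \<tau>1) p * (v \<tau>0 $ 2 + v \<tau>0 $ 3) = 1 + v \<tau>0 $ 3"
    and "j_fun (\<sigma>, \<tau>0, \<tau>1) p = 1 / (v \<tau>0 $ 2 + v \<tau>0 $ 3) ^ 3"
    and "l_fun (\<sigma>, \<tau>0, \<tau>1) p > 1"
proof -
  obtain x y where p: "p = (x, y)" by (cases p)
  have xy: "0 < y" "y < x" "x < 1" using assms(1) by (auto simp: open_triangle_def p)
  show D: "v \<tau>0 $ 2 + v \<tau>0 $ 3 > 0"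
    using xy by (cases \<tau>0) (simp_all add: v_def perm_nth bary_nth p)
  show l: "l_fun (\<sigma>, \<tau>0, \<tau>1) p * (v \<tau>0 $ 2 + v \<tau>0 $ 3) = 1 + v \<tau>0 $ 3"
    using xy by (cases \<tau>0) (simp_all add: v_def perm_nth bary_nth p divide_simps algebra_simps)
  show "j_fun (\<sigma>, \<tau>0, \<tau>1) p = 1 / (v \<tau>0 $ 2 + v \<tau>0 $ 3) ^ 3"
    using xy by (cases \<tau>0) (simp_all add: v_def perm_nth bary_nth p algebra_simps)
  have "v \<tau>0 $ 2 < 1" using xy by (cases \<tau>0) (simp_all add: v_def perm_nth bary_nth p)
  then have "1 * (v \<tau>0 $ 2 + v \<tau>0 $ 3) < l_fun (\<sigma>, \<tau>0, \<tau>1) p * (v \<tau>0 $ 2 + v \<tau>0 $ 3)"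
    unfolding l by simp
  then show "l_fun (\<sigma>, \<tau>0, \<tau>1) p > 1" using D by (simp only: mult_less_cancel_right_pos)
qed

lemma h_fun_Sk:
  assumes good: "(\<sigma>, \<tau>0, \<tau>1) \<in> good_triples" and p: "p \<in> open_triangle"
  defines "X \<equiv> (\<sigma>, \<tau>0, \<tau>1)"
  shows "h_fun \<sigma> (Sk X k p) = 1 / (real k + l_fun X p)"
    and "1 / (dpq X k p $ 1) ^ 3 = j_fun X p / (real k + l_fun X p) ^ 3"
proof -
  define D where "D = (perm_matrix \<tau>0 *v bary p) $ 2 + (perm_matrix \<tau>0 *v bary p) $ 3"
  note lj = l_fun_j_fun_eq(1)[OF p, of \<tau>0, folded D_def]
    l_fun_j_fun_eq(2-4)[OF p, of \<sigma> \<tau>0 \<tau>1, folded D_def X_def]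
  have d: "dpq X k p $ 1 = D * (real k + l_fun X p)"
    using good_branch(2)[OF good, of k p, folded X_def D_def] lj(2) by (simp add: algebra_simps)
  have "dpq X k p $ 1 * h_fun \<sigma> (Sk X k p) = D"
    using good_branch(1)[OF good, of k p, folded X_def D_def] arg_cong[OF bary_Sk[OF p, of X k], of "\<lambda>v. v $ fixed_coord \<sigma>"]
    by (simp add: h_fun_eq)
  then have "D * ((real k + l_fun X p) * h_fun \<sigma> (Sk X k p)) = D * 1"
    unfolding d by (simp only: mult.assoc mult_1_right)
  then have "(real k + l_fun X p) * h_fun \<sigma> (Sk X k p) = 1"
    using lj(1) by (simp only: mult_cancel_left) simp
  then show "h_fun \<sigma> (Sk X k p) = 1 / (real k + l_fun X p)"
    using lj(4) by (simp add: eq_divide_eq mult.commute)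
  show "1 / (dpq X k p $ 1) ^ 3 = j_fun X p / (real k + l_fun X p) ^ 3"
    unfolding d lj(3) by (simp add: power_mult_distrib)
qed

text \<open>The fixed argument of \<open>\<phi>\<close> is homogeneous of degree zero in the cone coordinates, so the denominator
  \<open>d\<^sub>k\<close> drops out.\<close>
lemma slice_bary:
  assumes "c \<noteq> 0" and "c *\<^sub>R bary p = w"
  shows "slice \<sigma> \<phi> p s = (case \<sigma> of
       S_e \<Rightarrow> \<phi> (w $ 3 / (w $ 2 + w $ 3)) s | S_23 \<Rightarrow> \<phi> (w $ 3 / (w $ 2 + w $ 3)) s
     | S_12 \<Rightarrow> \<phi> (- w $ 1 / w $ 3) s | S_13 \<Rightarrow> \<phi> s (w $ 1 / (w $ 1 + w $ 2))
     | S_123 \<Rightarrow> \<phi> ((w $ 1 + w $ 2) / w $ 2) s | S_132 \<Rightarrow> \<phi> s (w $ 3 / w $ 1))"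
proof -
  have w: "w $ 1 = c * (1 - fst p)" "w $ 2 = c * (fst p - snd p)" "w $ 3 = c * snd p"
    unfolding assms(2)[symmetric] by (simp_all add: bary_nth)
  have "w $ 2 + w $ 3 = c * fst p" "w $ 1 + w $ 2 = c * (1 - snd p)" "- w $ 1 = c * (fst p - 1)"
    by (simp_all add: w algebra_simps)
  then show ?thesis using assms(1) by (cases p; cases \<sigma>) (simp_all add: w)
qed

text \<open>For these pairs \<open>(\<sigma>, \<tau>\<^sub>1)\<close> the matrix \<open>F\<^sub>1\<close> fixes the two homogeneous coordinates that
  determine the fixed argument of \<open>\<phi>\<close>.\<close>
lemma slice_Sk_const:
  assumes good: "X \<in> good_triples" and "X \<notin> varying_triples" and X: "X = (\<sigma>, \<tau>0, \<tau>1)" and p: "p \<in> open_triangle"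
  shows "slice \<sigma> \<phi> (Sk X k p) s = phi_slice X \<phi> p s"
proof (induction k)
  case 0
  show ?case by (simp add: X)
next
  case (Suc k)
  have pair: "(\<sigma>, \<tau>1) \<in> {(S_e, S_e), (S_12, S_12), (S_13, S_13), (S_23, S_23), (S_123, S_132), (S_132, S_123)}"
    using assms(1,2) unfolding X good_triples_def
    by (elim insertE emptyE) (simp_all add: varying_triples_def)
  have d: "dpq X m p $ 1 \<noteq> 0" for m using dpq_pos[OF p, of X m] by simp
  have "slice \<sigma> \<phi> (Sk X (Suc k) p) s = slice \<sigma> \<phi> (Sk X k p) s"
    unfolding slice_bary[OF d bary_Sk[OF p]] cone_branch_Suc
    using pair by (auto simp: X F1_mult perm_nth A1_nth add.commute)
  then show ?case using Suc by simp
qed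

section \<open>The two formulas for the transfer operator\<close>

lemma sigma_finite_measure_lebesgue: "sigma_finite_measure (lebesgue :: real measure)"
proof
  show "\<exists>A::real set set. countable A \<and> A \<subseteq> sets lebesgue \<and> \<Union> A = space lebesgue \<and> (\<forall>a\<in>A. emeasure lebesgue a \<noteq> \<infinity>)"
  proof (intro exI[of _ "range (\<lambda>n::nat. {- real n..real n})"] conjI ballI)
    show "\<Union> (range (\<lambda>n::nat. {- real n..real n})) = space lebesgue"
    proof -
      have "\<exists>n::nat. x \<in> {- real n..real n}" for x
      proof -
        obtain n :: nat where "\<bar>x\<bar> \<le> real n" using real_arch_simple by blast
        then have "x \<in> {- real n..real n}" by auto
        then show ?thesis by blast
      qed
      then show ?thesis by auto
    qed
  qed auto
qed

text \<open>The density of \<open>dm\<close>, cut off at the open half line; the value at \<open>0\<close> is \<open>0\<close> either way, because division by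
  zero gives zero.\<close>
definition planck_weight :: "real \<Rightarrow> real" where
  "planck_weight t = indicator {0<..} t * (t / (exp t - 1))"

lemma planck_weight_nonneg: "planck_weight t \<ge> 0"
  by (auto simp: planck_weight_def indicator_def)

lemma borel_measurable_planck_weight [measurable]: "planck_weight \<in> borel_measurable borel"
  unfolding planck_weight_def[abs_def] by measurable

lemma dm_eq: "dm = density lebesgue (\<lambda>t. ennreal (planck_weight t))"
proof -
  have "indicator {0..} t * (t / (exp t - 1)) = planck_weight t" for t :: real
    by (cases "t = 0") (auto simp: planck_weight_def indicator_def)
  then show ?thesis by (simp add: dm_def)
qed

lemma planck_weight_measurable_lebesgue:
  "(\<lambda>t. ennreal (planck_weight t)) \<in> borel_measurable lebesgue"
  "planck_weight \<in> borel_measurable lebesgue"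
  by (auto intro!: measurable_completion)

lemma borel_measurable_dm_iff: "g \<in> borel_measurable dm \<longleftrightarrow> g \<in> borel_measurable lebesgue"
  by (simp add: dm_eq)

lemma borel_measurable_dmI: "g \<in> borel_measurable borel \<Longrightarrow> g \<in> borel_measurable dm"
  unfolding borel_measurable_dm_iff by (rule measurable_completion) simp

lemma sigma_finite_dm: "sigma_finite_measure dm"
  unfolding dm_eq
  using sigma_finite_measure.sigma_finite_iff_density_finite[OF sigma_finite_measure_lebesgue
      planck_weight_measurable_lebesgue(1)]
  by simp

lemma AE_dm_pos: "AE s in dm. s > 0"
  unfolding dm_eq AE_density[OF planck_weight_measurable_lebesgue(1)]
  by (auto simp: planck_weight_def indicator_def)

lemma
  fixes g :: "real \<Rightarrow> real"
  assumes "g \<in> borel_measurable borel"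
  shows integrable_dm_iff: "integrable dm g \<longleftrightarrow> integrable lborel (\<lambda>t. planck_weight t * g t)"
    and integral_dm: "integral\<^sup>L dm g = (LINT t|lborel. planck_weight t * g t)"
proof -
  have g: "g \<in> borel_measurable lebesgue" using assms by (auto intro!: measurable_completion)
  have wg: "(\<lambda>t. planck_weight t * g t) \<in> borel_measurable lborel" using assms by measurable
  show "integrable dm g \<longleftrightarrow> integrable lborel (\<lambda>t. planck_weight t * g t)"
    unfolding dm_eq
    by (subst integrable_density[OF g planck_weight_measurable_lebesgue(2)])
       (simp_all add: planck_weight_nonneg integrable_completion[OF wg])
  show "integral\<^sup>L dm g = (LINT t|lborel. planck_weight t * g t)"
    unfolding dm_eq
    by (subst integral_density[OF g planck_weight_measurable_lebesgue(2)])
       (simp_all add: planck_weight_nonneg integral_completion[OF wg])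
qed

text \<open>The operator \<open>K_op\<close> without its factor \<open>t / (exp t - 1)\<close>.\<close>
definition bessel_transform :: "(real \<Rightarrow> real) \<Rightarrow> real \<Rightarrow> real" where
  "bessel_transform \<psi> t = (LINT s|dm. bessel_kernel (s * t) * \<psi> s)"

lemma borel_measurable_bessel_transform:
  assumes [measurable]: "\<psi> \<in> borel_measurable dm"
  shows "bessel_transform \<psi> \<in> borel_measurable borel"
proof -
  interpret sigma_finite_measure dm by (rule sigma_finite_dm)
  have [measurable]: "(\<lambda>s. s) \<in> borel_measurable dm" by (rule borel_measurable_dmI) simp
  have "bessel_transform \<psi> \<in> borel_measurable lborel"
    unfolding bessel_transform_def[abs_def] by (rule borel_measurable_lebesgue_integral) measurable
  then show ?thesis by simp
qed

text \<open>The formulas for the Bessel function hold for \<open>s t > 0\<close>, that is, almost everywhere for \<open>dm\<close>.\<close>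
lemma
  fixes \<psi> :: "real \<Rightarrow> real"
  assumes t: "t > 0" and meas: "\<psi> \<in> borel_measurable dm"
  shows integrable_K_integrand_iff:
      "integrable dm (K_integrand \<psi> t) \<longleftrightarrow> integrable dm (\<lambda>s. bessel_kernel (s * t) * \<psi> s)"
    and K_op_eq: "K_op \<psi> t = planck_weight t * bessel_transform \<psi> t"
proof -
  let ?w = "t / (exp t - 1)"
  have w: "?w > 0" using t by simp
  have bk: "(\<lambda>s. bessel_kernel (s * t)) \<in> borel_measurable dm" by (rule borel_measurable_dmI) measurable
  have J: "(\<lambda>s. bessel_J1 (2 * sqrt (s * t)) / sqrt (s * t)) \<in> borel_measurable dm"
    unfolding bessel_J1_def by (rule borel_measurable_dmI) measurable
  have m1: "K_integrand \<psi> t \<in> borel_measurable dm"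
    unfolding K_integrand_def[abs_def] using J meas by (intro borel_measurable_times borel_measurable_const)
  have m2: "(\<lambda>s. ?w * (bessel_kernel (s * t) * \<psi> s)) \<in> borel_measurable dm"
    using bk meas by (intro borel_measurable_times borel_measurable_const)
  have eq: "AE s in dm. K_integrand \<psi> t s = ?w * (bessel_kernel (s * t) * \<psi> s)"
    using AE_dm_pos
  proof eventually_elim
    case (elim s)
    then show ?case using bessel_J1_eq_kernel[of "s * t"] t by (simp add: K_integrand_def)
  qed
  show "integrable dm (K_integrand \<psi> t) \<longleftrightarrow> integrable dm (\<lambda>s. bessel_kernel (s * t) * \<psi> s)"
    unfolding integrable_cong_AE[OF m1 m2 eq]
    by (rule trans[OF integrable_mult_left_iff]) (use w t in simp)
  show "K_op \<psi> t = planck_weight t * bessel_transform \<psi> t"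
    unfolding K_op_def integral_cong_AE[OF m1 m2 eq] using t
    by (simp add: planck_weight_def bessel_transform_def)
qed

lemma borel_measurable_laguerre [measurable]: "laguerre a k \<in> borel_measurable borel"
  unfolding laguerre_def[abs_def] by measurable

lemma bessel_integral_eq_planck_sum_integral:
  fixes \<psi> :: "real \<Rightarrow> real"
  assumes meas: "\<psi> \<in> borel_measurable dm" and decay_int: "integrable dm (\<lambda>s. decay s * \<psi> s)" and l: "l > 1"
    and outer: "set_integrable lebesgue {0..} (\<lambda>t. exp (- t * (l - 1)) * K_op \<psi> t)"
  shows "(LINT t:{0..}|lebesgue. exp (- t * (l - 1)) * K_op \<psi> t) = (LINT s|dm. planck_sum l s * \<psi> s)"
proof -
  let ?F = "bessel_transform \<psi>"
  let ?g = "\<lambda>t. indicator {0<..} t * (exp (- t * (l - 1)) * (t / (exp t - 1) * ?F t))"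
  have id: "(\<lambda>s. s) \<in> borel_measurable dm" by (rule borel_measurable_dmI) simp
  have nonneg: "AE s in dm. s \<ge> 0" using AE_dm_pos by eventually_elim simp
  note [measurable] = borel_measurable_bessel_transform[OF meas]
  have g_meas: "?g \<in> borel_measurable lborel" by measurable
  have m1: "(\<lambda>t. indicator {0..} t *\<^sub>R (exp (- t * (l - 1)) * K_op \<psi> t)) \<in> borel_measurable lebesgue"
    using outer unfolding set_integrable_def by (rule borel_measurable_integrable)
  have m2: "?g \<in> borel_measurable lebesgue" by (rule measurable_completion[OF g_meas])
  have eq: "AE t in lebesgue. indicator {0..} t *\<^sub>R (exp (- t * (l - 1)) * K_op \<psi> t) = ?g t"
  proof -
    have "AE t in lebesgue. t \<noteq> (0::real)"
      by (rule AE_completion) (rule AE_lborel_singleton)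
    then show ?thesis
    proof eventually_elim
      case (elim t)
      then show ?case
        using K_op_eq[OF _ meas, of t] by (cases "t > 0") (auto simp: planck_weight_def indicator_def)
    qed
  qed
  have "integrable lebesgue ?g"
    using outer unfolding set_integrable_def integrable_cong_AE[OF m1 m2 eq] .
  then have g_int: "integrable lborel ?g" by (simp only: integrable_completion[OF g_meas])
  have "(\<lambda>n. LINT t|lborel. indicator {0<..} t * (t * exp (- (real n + l) * t) * ?F t)) sums (LINT t|lborel. ?g t)"
    by (rule sums_planck_integral[OF _ g_int]) measurable
  moreover have "(LINT t|lborel. indicator {0<..} t * (t * exp (- (real n + l) * t) * ?F t))
      = (LINT s|dm. exp (- s / (real n + l)) / (real n + l)\<^sup>2 * \<psi> s)" for n
    unfolding bessel_transform_def
    using l by (intro laplace_bessel_transform[OF sigma_finite_dm id nonneg meas decay_int]) simp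
  ultimately have "(\<lambda>n. LINT s|dm. exp (- s / (real n + l)) / (real n + l)\<^sup>2 * \<psi> s) sums (LINT t|lborel. ?g t)"
    by simp
  then have "(LINT t|lborel. ?g t) = (LINT s|dm. planck_sum l s * \<psi> s)"
    using sums_planck_terms[OF id nonneg meas decay_int l] by (rule sums_unique2)
  moreover have "(LINT t:{0..}|lebesgue. exp (- t * (l - 1)) * K_op \<psi> t) = (LINT t|lborel. ?g t)"
    unfolding set_lebesgue_integral_def integral_cong_AE[OF m1 m2 eq] by (rule integral_completion[OF g_meas])
  ultimately show ?thesis by simp
qed

lemma laguerre_series_sums_planck_sum_integral:
  fixes \<psi> :: "real \<Rightarrow> real"
  assumes meas: "\<psi> \<in> borel_measurable dm" and decay_int: "integrable dm (\<lambda>s. decay s * \<psi> s)" and l: "l > 1"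
    and inner: "\<And>k. integrable dm (\<lambda>s. \<psi> s * eta k s)"
    and E_int: "\<And>k. integrable dm (\<lambda>t. exp (- t * (l - 1)) * laguerre 1 k t)"
  shows "(\<lambda>k. dm_inner \<psi> (eta k) * (LINT t|dm. exp (- t * (l - 1)) * laguerre 1 k t)) sums
    (LINT s|dm. planck_sum l s * \<psi> s)"
  unfolding dm_inner_def
proof (rule sums_laguerre_terms[OF _ _ meas decay_int l _ inner])
  show "(\<lambda>s. s) \<in> borel_measurable dm" by (rule borel_measurable_dmI) simp
  show "AE s in dm. s \<ge> 0" using AE_dm_pos by eventually_elim simp
  fix k
  let ?L = "\<lambda>t. exp (- t * (l - 1)) * laguerre 1 k t"
  have L: "?L \<in> borel_measurable borel" by measurable
  have eq: "(\<lambda>t. planck_weight t * ?L t)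
      = (\<lambda>t. indicator {0<..} t * (exp (- t * (l - 1)) * (t / (exp t - 1) * laguerre 1 k t)))"
    by (simp add: planck_weight_def fun_eq_iff mult_ac)
  have int: "integrable lborel (\<lambda>t. indicator {0<..} t * (exp (- t * (l - 1)) * (t / (exp t - 1) * laguerre 1 k t)))"
    using E_int[of k] unfolding integrable_dm_iff[OF L] eq .
  have "(\<lambda>n. LINT t|lborel. indicator {0<..} t * (t * exp (- (real n + l) * t) * laguerre 1 k t)) sums (LINT t|dm. ?L t)"
    unfolding integral_dm[OF L] eq by (rule sums_planck_integral[OF _ int]) measurable
  moreover have "(LINT t|lborel. indicator {0<..} t * (t * exp (- (real n + l) * t) * laguerre 1 k t))
      = (real k + 1) * (1 - 1 / (real n + l)) ^ k / (real n + l)\<^sup>2" for n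
    using has_bochner_integral_laplace_laguerre[of "real n + l" k] l by (auto simp: has_bochner_integral_iff)
  ultimately show "(\<lambda>n. (real k + 1) * (1 - 1 / (real n + l)) ^ k / (real n + l)\<^sup>2) sums (LINT t|dm. ?L t)"
    by simp
qed

theorem theorem7:
  fixes \<sigma> \<tau>0 \<tau>1 :: s3
    and X :: triple
    and f :: "real \<times> real \<Rightarrow> real"
    and \<phi> :: "real \<Rightarrow> real \<Rightarrow> real"
  assumes X_def: "X = (\<sigma>, \<tau>0, \<tau>1)"
    and X_good: "X \<in> good_triples"
    and f_hat: "\<And>p. p \<in> open_triangle \<Longrightarrow> f p = hat \<sigma> \<phi> p"
    and one_slice: "\<And>p k s. X \<in> varying_triples \<Longrightarrow> p \<in> open_triangle \<Longrightarrow> s > 0 \<Longrightarrow>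
          slice \<sigma> \<phi> (Sk X k p) s = phi_slice X \<phi> p s"
    and hat_exists: "\<And>p. p \<in> open_triangle \<Longrightarrow> integrable dm (hat_integrand \<sigma> \<phi> p)"
    and transfer_exists: "\<And>p. p \<in> open_triangle \<Longrightarrow>
          (\<lambda>q. f q / \<bar>jac_det (tp_map X) q\<bar>) summable_on preimages X p"
    and K_exists: "\<And>p t. p \<in> open_triangle \<Longrightarrow> t > 0 \<Longrightarrow>
          integrable dm (K_integrand (phi_slice X \<phi> p) t)"
    and outer_exists: "\<And>p. p \<in> open_triangle \<Longrightarrow>
          set_integrable lebesgue {0..}
            (\<lambda>t. exp (- t * (l_fun X p - 1)) * K_op (phi_slice X \<phi> p) t)"
    and inner_exists: "\<And>p k. p \<in> open_triangle \<Longrightarrow>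
          integrable dm (\<lambda>s. phi_slice X \<phi> p s * eta k s)"
    and E_exists: "\<And>p k. p \<in> open_triangle \<Longrightarrow> integrable dm (E_integrand X k p)"
    and series_exists: "\<And>p. p \<in> open_triangle \<Longrightarrow>
          summable (\<lambda>k. dm_inner (phi_slice X \<phi> p) (eta k) * E_fun X k p)"
  shows "\<forall>p\<in>open_triangle.
      transfer_operator X f p
        = j_fun X p * (LINT t:{0..}|lebesgue.
            exp (- t * (l_fun X p - 1)) * K_op (phi_slice X \<phi> p) t)
    \<and> transfer_operator X f p
        = (\<Sum>k. dm_inner (phi_slice X \<phi> p) (eta k) * E_fun X k p)"
proof
  fix p assume p: "p \<in> open_triangle"
  define \<psi> l j where "\<psi> = phi_slice X \<phi> p" and "l = l_fun X p" and "j = j_fun X p"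
  have good: "(\<sigma>, \<tau>0, \<tau>1) \<in> good_triples" using X_good X_def by simp
  have l: "l > 1" unfolding l_def X_def by (rule l_fun_j_fun_eq(4)[OF p])
  have j: "j > 0"
    unfolding j_def X_def l_fun_j_fun_eq(3)[OF p] using l_fun_j_fun_eq(1)[OF p, of \<tau>0] by simp
  have slice: "slice \<sigma> \<phi> (Sk X k p) s = \<psi> s" if "s > 0" for k s
    unfolding \<psi>_def using one_slice[OF _ p that] slice_Sk_const[OF X_good _ X_def p] by blast
  have h: "h_fun \<sigma> (Sk X k p) = 1 / (real k + l)"
    and d: "1 / (dpq X k p $ 1) ^ 3 = j / (real k + l) ^ 3" for k
    using h_fun_Sk[OF good p, of k] unfolding X_def[symmetric] l_def j_def by auto
  have slice_0: "slice \<sigma> \<phi> (Sk X 0 p) = \<psi>" by (simp add: \<psi>_def X_def fun_eq_iff)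
  have id: "(\<lambda>s. s) \<in> borel_measurable dm" by (rule borel_measurable_dmI) simp
  have nonneg: "AE s in dm. s \<ge> 0" using AE_dm_pos by eventually_elim simp
  \<comment> \<open>The transform exists at the preimage with index \<open>0\<close>, where \<open>h\<close> is \<open>1 / l\<close>.\<close>
  have exp_int: "integrable dm (\<lambda>s. exp (- s * (1 / l)) * \<psi> s)"
    using hat_exists[OF Sk_in_open_triangle[OF p], of X 0]
    unfolding hat_integrand_def[abs_def] slice_0 h[of 0] by simp
  have meas: "\<psi> \<in> borel_measurable dm"
  proof -
    have "(\<lambda>s. exp (s * (1 / l))) \<in> borel_measurable dm" by (rule borel_measurable_dmI) measurable
    then have "(\<lambda>s. exp (s * (1 / l)) * (exp (- s * (1 / l)) * \<psi> s)) \<in> borel_measurable dm"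
      using borel_measurable_integrable[OF exp_int] by (rule borel_measurable_times)
    moreover have "exp (s * (1 / l)) * (exp (- s * (1 / l)) * \<psi> s) = \<psi> s" for s
      by (simp add: exp_minus)
    ultimately show ?thesis by (simp only:)
  qed
  have decay_int: "integrable dm (\<lambda>s. decay s * \<psi> s)"
  proof (rule decay_integrable_if_bessel_integrable[OF sigma_finite_dm id nonneg meas exp_int])
    show "integrable dm (\<lambda>s. bessel_kernel (s * t) * \<psi> s)" if "t > 0" for t
      using K_exists[OF p that] integrable_K_integrand_iff[OF that meas] unfolding \<psi>_def by blast
  qed
  let ?I = "LINT s|dm. planck_sum l s * \<psi> s"
  have "f (Sk X k p) / (dpq X k p $ 1) ^ 3 = j * (LINT s|dm. exp (- s / (real k + l)) / (real k + l)\<^sup>2 * \<psi> s)" for k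
  proof -
    define \<nu> where "\<nu> = real k + l"
    have \<nu>: "\<nu> > 0" using l by (simp add: \<nu>_def)
    let ?P = "LINT s|dm. exp (- s / \<nu>) * \<psi> s"
    have e_meas: "(\<lambda>s. exp (- s / \<nu>)) \<in> borel_measurable dm" by (rule borel_measurable_dmI) measurable
    have "(LINT s|dm. hat_integrand \<sigma> \<phi> (Sk X k p) s) = ?P"
    proof (rule integral_cong_AE)
      show "AE s in dm. hat_integrand \<sigma> \<phi> (Sk X k p) s = exp (- s / \<nu>) * \<psi> s"
        using AE_dm_pos by eventually_elim (simp add: hat_integrand_def slice h \<nu>_def)
      show "hat_integrand \<sigma> \<phi> (Sk X k p) \<in> borel_measurable dm"
        using hat_exists[OF Sk_in_open_triangle[OF p]] by (rule borel_measurable_integrable)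
      show "(\<lambda>s. exp (- s / \<nu>) * \<psi> s) \<in> borel_measurable dm"
        using e_meas meas by (rule borel_measurable_times)
    qed
    then have "f (Sk X k p) = \<nu> * ?P"
      by (simp add: f_hat[OF Sk_in_open_triangle[OF p]] hat_def h \<nu>_def)
    then have "f (Sk X k p) / (dpq X k p $ 1) ^ 3 = \<nu> * ?P * (j / \<nu> ^ 3)"
      using d[of k, folded \<nu>_def] by (simp add: divide_inverse)
    also have "\<dots> = j * (1 / \<nu>\<^sup>2 * ?P)"
      using \<nu> by (simp add: power2_eq_square power3_eq_cube)
    also have "1 / \<nu>\<^sup>2 * ?P = (LINT s|dm. 1 / \<nu>\<^sup>2 * (exp (- s / \<nu>) * \<psi> s))" by simp
    finally show ?thesis by (simp add: \<nu>_def)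
  qed
  then have "(\<lambda>k. j * (LINT s|dm. exp (- s / (real k + l)) / (real k + l)\<^sup>2 * \<psi> s)) sums transfer_operator X f p"
    using transfer_operator_sums[OF p transfer_exists[OF p]] by simp
  then have T: "transfer_operator X f p = j * ?I"
    using sums_mult[OF sums_planck_terms[OF id nonneg meas decay_int l]] by (rule sums_unique2)
  have bessel: "(LINT t:{0..}|lebesgue. exp (- t * (l - 1)) * K_op \<psi> t) = ?I"
    using outer_exists[OF p] unfolding \<psi>_def[symmetric] l_def[symmetric]
    by (rule bessel_integral_eq_planck_sum_integral[OF meas decay_int l])
  let ?L = "\<lambda>k t. exp (- t * (l - 1)) * laguerre 1 k t"
  have E_integrand: "E_integrand X k p = (\<lambda>t. j * ?L k t)" for k
    by (simp add: E_integrand_def fun_eq_iff j_def l_def)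
  have "integrable dm (?L k)" for k
    using E_exists[OF p, of k] j unfolding E_integrand by simp
  then have "(\<lambda>k. dm_inner \<psi> (eta k) * (LINT t|dm. ?L k t)) sums ?I"
    using inner_exists[OF p] unfolding \<psi>_def[symmetric]
    by (intro laguerre_series_sums_planck_sum_integral[OF meas decay_int l])
  then have "(\<lambda>k. j * (dm_inner \<psi> (eta k) * (LINT t|dm. ?L k t))) sums (j * ?I)" by (rule sums_mult)
  moreover have "E_fun X k p = j * (LINT t|dm. ?L k t)" for k
    by (simp add: E_fun_def E_integrand)
  ultimately have "(\<lambda>k. dm_inner \<psi> (eta k) * E_fun X k p) sums (j * ?I)"
    by (simp add: mult_ac)
  then have series: "(\<Sum>k. dm_inner \<psi> (eta k) * E_fun X k p) = j * ?I" by (simp add: sums_iff)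
  show "transfer_operator X f p
        = j_fun X p * (LINT t:{0..}|lebesgue.
            exp (- t * (l_fun X p - 1)) * K_op (phi_slice X \<phi> p) t)
    \<and> transfer_operator X f p
        = (\<Sum>k. dm_inner (phi_slice X \<phi> p) (eta k) * E_fun X k p)"
    using T bessel series by (simp add: \<psi>_def l_def j_def)
qed

end
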